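(* Consider the problem $$-\operatorname{div}_S\bigl(b(x,u,\nabla_Su)\,\nabla_Su\bigr)=f(x)\ \text{ on }S,\qquad u=g\ \text{ on }\partial S,$$ under assumptions (A1)–(A3) of the context. Let the triangulation $\mathcal T_h$ (as in the context) satisfy $$\nabla_{S_h}\chi_i\cdot\nabla_{S_h}\chi_j\le0\quad\text{on }S_h$$ for all $i=1,\dots,n$, $j=1,\dots,\bar n$, $i\neq j$. Let $u_h\in V_h$ be a solution of the discrete problem in the context. Then: (1) If $f\le0$ then $\displaystyle\max_{\overline S}u_h^l=\max_{\partial S}g_h^l$. (2) If $f\ge0$ then $\displaystyle\min_{\overline S}u_h^l=\min_{\partial S}g_h^l$. (3) If $f=0$ then the ranges of $u_h^l$ and $g_h^l$ coincide, i.e. $[\min_{\overline S}u_h^l,\max_{\overline S}u_h^l]=[\min_{\partial S}g_h^l,\max_{\partial S}g_h^l]$.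
   Context: Continuous data. $\mathcal M$ is a smooth complete $d$-dimensional Riemannian manifold, $S\subset\mathcal M$ a closed bounded regular subdomain, a smooth manifold with nonempty boundary $\partial S$. $S$ is embedded as a hypersurface in $\mathbb R^{d+1}$ with unit normal $\nu$, with an associated signed distance function $\delta$ such that $S=\{\delta=0\}$ and $\nabla\delta=\nu$ (on the set of points $P+s\nu(P)$, $P\in S$, $|s|$ small, where $\delta(P+s\nu(P))=s$). $p'=p/(p-1)$. Assumptions: (A1) $p\ge2$ is a given parameter. (A2) $b:S\times\mathbb R\times\mathbb R^{d+1}\to\mathbb R$ is continuous; $f\in L^{p'}(S)$; $g=g^*|_{\partial S}$ for some $g^*\in W^{1,\gamma}(S)$, where $\gamma\ge p$ if $p>d$ and $\gamma>d$ if $p\le d$. (A3) There are constants $\mu_0,\mu_1,M_0,M_1>0$ with $\mu_0+\mu_1|\xi|^{p-2}\le b(x,z,\xi)\le M_0+M_1|\xi|^{p-2}$ for all $(x,z,\xi)\in S\times\mathbb R\times\mathbb R^{d+1}$. Discretization. $S$ is approximated by a polyhedral surface $S_h=\bigcup_{T\in\mathcal T_h}T\subset\mathbb R^{d+1}$, where $\mathcal T_h$ is an admissible triangulation by $d$-simplices: $h$ is the maximal diameter, every $T$ has inradius at least $ch$ with $c>0$, and $S_h$ is not a global double covering of $S$. The vertices $B_1,\dots,B_{\bar n}$ lie on $S$; $B_1,\dots,B_n$ (with $n<\bar n$) are those not on $\partial S_h$, and $B_{n+1},\dots,B_{\bar n}$ are those on $\partial S_h$, which lie on $\partial S$. $\nabla_{S_h}\phi=\nabla\phi-(\nabla\phi\cdot\nu_h)\nu_h$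 (elementwise, $\nu_h$ the normal to $S_h$). $\chi_j$ is the continuous piecewise linear function on $S_h$ with $\chi_j(B_i)=\delta_{ij}$; $V_h=\operatorname{span}\{\chi_1,\dots,\chi_{\bar n}\}$, $V_h^0=\operatorname{span}\{\chi_1,\dots,\chi_n\}$. $g_h=\sum_{j=n+1}^{\bar n}g_j\chi_j$ with $g_j=g(B_j)$. Lift. Each $x\in S_h$ determines a unique $P=P(x)\in S$ by $x=P+\nu(P)\delta(x)$; $h$ is small enough that this is well defined, and $x\mapsto P(x)$ is regarded as a bijection of $S_h$ onto $S$ mapping $\partial S_h$ onto $\partial S$. The lift of $\eta_h:S_h\to\mathbb R$ is $\eta_h^l(P(x))=\eta_h(x)$. For the data, $b^{-l}(x,\cdot,\cdot)=b(P(x),\cdot,\cdot)$, $f^{-l}(x)=f(P(x))$. In (3), the ranges are those of $u_h^l$ on $\overline S$ and of $g_h^l$ on $\partial S$, understood as the stated intervals. Discrete problem: find $u_h\in V_h$ with $u_h-g_h\in V_h^0$ and $$\int_{S_h}b^{-l}(x,u_h,\nabla_{S_h}u_h)\nabla_{S_h}u_h\cdot\nabla_{S_h}v_h=\int_{S_h}f^{-l}v_h\quad\forall v_h\in V_h^0.$$ *)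

theory Defs
  imports "HOL-Analysis.Analysis"
begin

section \<open>Surface measure and Lebesgue spaces\<close>

text \<open>The surface measure, on the smooth surface as well as on flat simplices, is the
  \<open>d\<close>-dimensional Hausdorff measure, normalised so that it agrees with Lebesgue measure on
  \<open>d\<close>-dimensional affine subspaces. It is meant for \<open>d \<ge> 1\<close>. The library's
  \<^const>\<open>diameter\<close> is meaningful for bounded sets only, hence the boundedness condition on
  covers.\<close>

definition hausdorff_pre :: "nat \<Rightarrow> real \<Rightarrow> 'a::metric_space set \<Rightarrow> ennreal" where
  "hausdorff_pre d \<epsilon> A =
     (INF C \<in> {C :: nat \<Rightarrow> 'a set. A \<subseteq> (\<Union>i. C i) \<and> (\<forall>i. bounded (C i) \<and> diameter (C i) \<le> \<epsilon>)}.
        \<Sum>i. ennreal (unit_ball_vol (real d) * (diameter (C i) / 2) ^ d))"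

definition hausdorff_outer :: "nat \<Rightarrow> 'a::metric_space set \<Rightarrow> ennreal" where
  "hausdorff_outer d A = (SUP \<epsilon> \<in> {0<..}. hausdorff_pre d \<epsilon> A)"

definition hausdorff_measure :: "nat \<Rightarrow> 'a::metric_space measure" where
  "hausdorff_measure d = measure_of UNIV (sets borel) (hausdorff_outer d)"

definition surf :: "nat \<Rightarrow> 'a::metric_space set \<Rightarrow> 'a measure" where
  "surf d A = restrict_space (hausdorff_measure d) A"

definition in_Lp :: "'a measure \<Rightarrow> real \<Rightarrow> ('a \<Rightarrow> 'b::euclidean_space) \<Rightarrow> bool" where
  "in_Lp M q f \<longleftrightarrow> f \<in> borel_measurable M \<and> integrable M (\<lambda>x. norm (f x) powr q)"


section \<open>Smooth hypersurfaces with boundary\<close>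

text \<open>\<open>Ck_on k U f\<close>: \<open>f\<close> is \<open>k\<close> times continuously differentiable on the open set \<open>U\<close>
  (continuity of all iterated directional derivatives).\<close>

primrec Ck_on ::
  "nat \<Rightarrow> 'a::euclidean_space set \<Rightarrow> ('a \<Rightarrow> 'b::euclidean_space) \<Rightarrow> bool" where
  "Ck_on 0 U f = continuous_on U f"
| "Ck_on (Suc k) U f =
     (\<exists>f'. (\<forall>x\<in>U. (f has_derivative f' x) (at x)) \<and> (\<forall>v. Ck_on k U (\<lambda>x. f' x v)))"

definition smooth_on :: "'a::euclidean_space set \<Rightarrow> ('a \<Rightarrow> 'b::euclidean_space) \<Rightarrow> bool" where
  "smooth_on U f \<longleftrightarrow> (\<forall>k. Ck_on k U f)"

definition diffeo :: "'a::euclidean_space set \<Rightarrow> 'a set \<Rightarrow> ('a \<Rightarrow> 'a) \<Rightarrow> bool" where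
  "diffeo W V \<Phi> \<longleftrightarrow> open W \<and> open V \<and> smooth_on W \<Phi> \<and>
     (\<exists>\<Psi>. smooth_on V \<Psi> \<and> homeomorphism W V \<Phi> \<Psi>)"

text \<open>Near an interior point a hypersurface is straightened to the hyperplane
  \<open>y \<bullet> e = 0\<close>, near a boundary point to the half-hyperplane \<open>y \<bullet> e = 0, y \<bullet> e' \<ge> 0\<close>, the point
  itself lying on its edge.\<close>

definition hs_interior :: "'a::euclidean_space set \<Rightarrow> 'a set" where
  "hs_interior S = {p \<in> S. \<exists>W V \<Phi>. \<exists>e\<in>Basis. diffeo W V \<Phi> \<and> p \<in> W \<and>
     \<Phi> ` (S \<inter> W) = {y \<in> V. y \<bullet> e = 0}}"

definition hs_boundary :: "'a::euclidean_space set \<Rightarrow> 'a set" where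
  "hs_boundary S = {p \<in> S. \<exists>W V \<Phi>. \<exists>e\<in>Basis. \<exists>e'\<in>Basis. e \<noteq> e' \<and> diffeo W V \<Phi> \<and> p \<in> W \<and>
     \<Phi> p \<bullet> e' = 0 \<and> \<Phi> ` (S \<inter> W) = {y \<in> V. y \<bullet> e = 0 \<and> y \<bullet> e' \<ge> 0}}"

text \<open>A closed bounded regular subdomain of a complete Riemannian manifold is compact
  (Hopf--Rinow) and, being a domain, connected. The ambient manifold plays no other role.\<close>

definition regular_hypersurface :: "'a::euclidean_space set \<Rightarrow> bool" where
  "regular_hypersurface S \<longleftrightarrow> compact S \<and> connected S \<and>
     S = hs_interior S \<union> hs_boundary S \<and> hs_boundary S \<noteq> {}"

text \<open>Velocities of curves issuing from \<open>p\<close> form only a half space at boundary points; their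
  span is the full tangent space there too.\<close>

definition tangent_space :: "'a::euclidean_space set \<Rightarrow> 'a \<Rightarrow> 'a set" where
  "tangent_space S p = span {v. \<exists>c :: real \<Rightarrow> 'a. c 0 = p \<and> (\<forall>t\<in>{0..1}. c t \<in> S) \<and>
     (c has_vector_derivative v) (at 0 within {0..1})}"

definition unit_normal :: "'a::euclidean_space set \<Rightarrow> ('a \<Rightarrow> 'a) \<Rightarrow> bool" where
  "unit_normal S \<nu> \<longleftrightarrow> continuous_on S \<nu> \<and>
     (\<forall>p\<in>S. norm (\<nu> p) = 1 \<and> (\<forall>v\<in>tangent_space S p. \<nu> p \<bullet> v = 0))"

definition tube :: "'a::euclidean_space set \<Rightarrow> ('a \<Rightarrow> 'a) \<Rightarrow> real \<Rightarrow> 'a set" where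
  "tube S \<nu> \<epsilon> = {q + s *\<^sub>R \<nu> q | q s. q \<in> S \<and> \<bar>s\<bar> < \<epsilon>}"

text \<open>The tube is not a neighbourhood of \<open>hs_boundary S\<close>, so the gradient of \<open>\<delta>\<close> is taken
  within the tube.\<close>

definition signed_distance ::
  "'a::euclidean_space set \<Rightarrow> ('a \<Rightarrow> 'a) \<Rightarrow> real \<Rightarrow> ('a \<Rightarrow> real) \<Rightarrow> bool" where
  "signed_distance S \<nu> \<epsilon> \<delta> \<longleftrightarrow> \<epsilon> > 0 \<and>
     {x \<in> tube S \<nu> \<epsilon>. \<delta> x = 0} = S \<and>
     (\<forall>x\<in>tube S \<nu> \<epsilon>. \<bar>\<delta> x\<bar> = infdist x S) \<and>
     (\<forall>q\<in>S. \<forall>s. \<bar>s\<bar> < \<epsilon> \<longrightarrow> \<delta> (q + s *\<^sub>R \<nu> q) = s \<and>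
        (\<delta> has_derivative (\<lambda>v. \<nu> q \<bullet> v)) (at (q + s *\<^sub>R \<nu> q) within tube S \<nu> \<epsilon>))"


section \<open>Tangential gradients and Sobolev functions\<close>

definition tang :: "'a::real_inner \<Rightarrow> 'a \<Rightarrow> 'a" where
  "tang n a = a - (a \<bullet> n) *\<^sub>R n"

definition grad :: "('a::real_inner \<Rightarrow> real) \<Rightarrow> 'a \<Rightarrow> 'a" where
  "grad \<phi> x = (THE a. (\<phi> has_derivative (\<lambda>v. a \<bullet> v)) (at x))"

text \<open>The Sobolev space is the completion of the smooth functions: on a compact hypersurface with
  boundary these are the restrictions of smooth functions on the ambient space. \<open>G\<close> is the weak
  tangential gradient of \<open>u\<close>.\<close>

definition in_W1 ::
  "nat \<Rightarrow> 'a::euclidean_space set \<Rightarrow> ('a \<Rightarrow> 'a) \<Rightarrow> real \<Rightarrow> ('a \<Rightarrow> real) \<Rightarrow> bool" where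
  "in_W1 d S \<nu> \<gamma> u \<longleftrightarrow> in_Lp (surf d S) \<gamma> u \<and>
     (\<exists>G (\<phi> :: nat \<Rightarrow> 'a \<Rightarrow> real). in_Lp (surf d S) \<gamma> G \<and> (\<forall>k. smooth_on UNIV (\<phi> k)) \<and>
        (\<lambda>k. \<integral>\<^sup>+x. ennreal (\<bar>\<phi> k x - u x\<bar> powr \<gamma>) \<partial>surf d S) \<longlonglongrightarrow> 0 \<and>
        (\<lambda>k. \<integral>\<^sup>+x. ennreal (norm (tang (\<nu> x) (grad (\<phi> k) x) - G x) powr \<gamma>) \<partial>surf d S)
          \<longlonglongrightarrow> 0)"

text \<open>\<open>|\<xi>|\<^sup>r\<close> with the convention \<open>0\<^sup>0 = 1\<close>, which \<^const>\<open>powr\<close> does not follow; it matters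
  for \<open>p = 2\<close>.\<close>

definition norm_pow :: "'a::real_normed_vector \<Rightarrow> real \<Rightarrow> real" where
  "norm_pow \<xi> r = (if r = 0 then 1 else norm \<xi> powr r)"


section \<open>Polyhedral surfaces and finite elements\<close>

definition mesh_size :: "'a::euclidean_space set set \<Rightarrow> real" where
  "mesh_size \<T> = Max (diameter ` \<T>)"

definition inradius :: "'a::euclidean_space set \<Rightarrow> real" where
  "inradius T = Sup {r. r \<ge> 0 \<and> (\<exists>x\<in>T. cball x r \<inter> affine hull T \<subseteq> T)}"

definition admissible_mesh :: "nat \<Rightarrow> real \<Rightarrow> 'a::euclidean_space set set \<Rightarrow> bool" where
  "admissible_mesh d c \<T> \<longleftrightarrow> triangulation \<T> \<and> \<T> \<noteq> {} \<and> (\<forall>T\<in>\<T>. int d simplex T) \<and>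
     c > 0 \<and> (\<forall>T\<in>\<T>. inradius T \<ge> c * mesh_size \<T>)"

definition mesh_boundary :: "'a::euclidean_space set set \<Rightarrow> 'a set" where
  "mesh_boundary \<T> = \<Union>{F. \<exists>!T. T \<in> \<T> \<and> F facet_of T}"

definition mesh_vertices :: "'a::euclidean_space set set \<Rightarrow> 'a set" where
  "mesh_vertices \<T> = {v. \<exists>T\<in>\<T>. v extreme_point_of T}"

definition numbered_vertices ::
  "'a::euclidean_space set \<Rightarrow> 'a set set \<Rightarrow> nat \<Rightarrow> nat \<Rightarrow> (nat \<Rightarrow> 'a) \<Rightarrow> bool" where
  "numbered_vertices S \<T> n N B \<longleftrightarrow> n < N \<and> bij_betw B {1..N} (mesh_vertices \<T>) \<and>
     (\<forall>i\<in>{1..N}. B i \<in> S) \<and>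
     (\<forall>i\<in>{1..n}. B i \<notin> mesh_boundary \<T>) \<and>
     (\<forall>i\<in>{n+1..N}. B i \<in> mesh_boundary \<T> \<and> B i \<in> hs_boundary S)"

definition nodal_basis ::
  "'a::euclidean_space set set \<Rightarrow> nat \<Rightarrow> (nat \<Rightarrow> 'a) \<Rightarrow> (nat \<Rightarrow> 'a \<Rightarrow> real) \<Rightarrow> bool" where
  "nodal_basis \<T> N B hat \<longleftrightarrow> (\<forall>j\<in>{1..N}. continuous_on (\<Union>\<T>) (hat j) \<and>
     (\<forall>T\<in>\<T>. \<exists>a c. \<forall>x\<in>T. hat j x = a \<bullet> x + c) \<and>
     (\<forall>i\<in>{1..N}. hat j (B i) = (if i = j then 1 else 0)))"

text \<open>Functions on \<open>\<Union>\<T>\<close> are represented by functions on the whole space, whose values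
  elsewhere are irrelevant.\<close>

definition fe_span ::
  "'a::euclidean_space set set \<Rightarrow> (nat \<Rightarrow> 'a \<Rightarrow> real) \<Rightarrow> nat set \<Rightarrow> ('a \<Rightarrow> real) set" where
  "fe_span \<T> hat J = {v. \<exists>c :: nat \<Rightarrow> real. \<forall>x\<in>\<Union>\<T>. v x = (\<Sum>j\<in>J. c j * hat j x)}"

text \<open>On a \<open>d\<close>-simplex in \<open>(d+1)\<close>-space the unit normal is unique up to sign, and the ambient
  gradients \<open>a\<close> of the affine extensions of \<open>\<phi>\<close> differ by multiples of it only, so
  \<open>elt_grad T \<phi>\<close> does not depend on the choices.\<close>

definition elt_normal :: "'a::euclidean_space set \<Rightarrow> 'a" where
  "elt_normal T = (SOME m. norm m = 1 \<and> (\<forall>x\<in>T. \<forall>y\<in>T. m \<bullet> (x - y) = 0))"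

definition elt_grad :: "'a::euclidean_space set \<Rightarrow> ('a \<Rightarrow> real) \<Rightarrow> 'a" where
  "elt_grad T \<phi> = tang (elt_normal T) (SOME a. \<exists>c. \<forall>x\<in>T. \<phi> x = a \<bullet> x + c)"


section \<open>Lift and discrete problem\<close>

definition foot :: "'a::euclidean_space set \<Rightarrow> ('a \<Rightarrow> 'a) \<Rightarrow> ('a \<Rightarrow> real) \<Rightarrow> 'a \<Rightarrow> 'a" where
  "foot S \<nu> \<delta> x = (THE q. q \<in> S \<and> x = q + \<delta> x *\<^sub>R \<nu> q)"

text \<open>The last condition says that \<open>x \<mapsto> f (foot S \<nu> \<delta> x)\<close> is well defined for classes of
  functions modulo equality almost everywhere, such as elements of Lebesgue spaces on \<open>S\<close>.
  Bijectivity onto the connected surface \<open>S\<close> rules out a global double covering.\<close>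

definition lift_well_defined ::
  "nat \<Rightarrow> 'a::euclidean_space set \<Rightarrow> ('a \<Rightarrow> 'a) \<Rightarrow> real \<Rightarrow> ('a \<Rightarrow> real) \<Rightarrow> 'a set set \<Rightarrow> bool" where
  "lift_well_defined d S \<nu> \<epsilon> \<delta> \<T> \<longleftrightarrow> \<Union>\<T> \<subseteq> tube S \<nu> \<epsilon> \<and>
     (\<forall>x\<in>\<Union>\<T>. \<exists>!q. q \<in> S \<and> x = q + \<delta> x *\<^sub>R \<nu> q) \<and>
     bij_betw (foot S \<nu> \<delta>) (\<Union>\<T>) S \<and>
     foot S \<nu> \<delta> ` mesh_boundary \<T> = hs_boundary S \<and>
     (\<forall>Z. Z \<subseteq> S \<and> Z \<in> null_sets (hausdorff_measure d) \<longrightarrow>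
        {x \<in> \<Union>\<T>. foot S \<nu> \<delta> x \<in> Z} \<in> null_sets (hausdorff_measure d))"

definition lift :: "'a set set \<Rightarrow> ('a \<Rightarrow> 'a) \<Rightarrow> ('a \<Rightarrow> real) \<Rightarrow> 'a \<Rightarrow> real" where
  "lift \<T> P \<phi> y = \<phi> (inv_into (\<Union>\<T>) P y)"

definition boundary_interpolant ::
  "nat \<Rightarrow> nat \<Rightarrow> (nat \<Rightarrow> 'a) \<Rightarrow> (nat \<Rightarrow> 'a \<Rightarrow> real) \<Rightarrow> ('a \<Rightarrow> real) \<Rightarrow> 'a \<Rightarrow> real" where
  "boundary_interpolant n N B hat g x = (\<Sum>j\<in>{n+1..N}. g (B j) * hat j x)"

text \<open>Distinct elements overlap in null sets only, so integrals over \<open>\<Union>\<T>\<close> are sums over the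
  elements, on each of which the gradients are constant. That the integrals exist is part of
  being a solution.\<close>

definition discrete_solution ::
  "nat \<Rightarrow> 'a::euclidean_space set set \<Rightarrow> nat \<Rightarrow> nat \<Rightarrow> (nat \<Rightarrow> 'a \<Rightarrow> real) \<Rightarrow> ('a \<Rightarrow> 'a) \<Rightarrow>
   ('a \<Rightarrow> real \<Rightarrow> 'a \<Rightarrow> real) \<Rightarrow> ('a \<Rightarrow> real) \<Rightarrow> ('a \<Rightarrow> real) \<Rightarrow> ('a \<Rightarrow> real) \<Rightarrow> bool" where
  "discrete_solution d \<T> n N hat P b f gh u \<longleftrightarrow>
     u \<in> fe_span \<T> hat {1..N} \<and> (\<lambda>x. u x - gh x) \<in> fe_span \<T> hat {1..n} \<and>
     (\<forall>v\<in>fe_span \<T> hat {1..n}.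
        (\<forall>T\<in>\<T>. integrable (surf d T)
                   (\<lambda>x. b (P x) (u x) (elt_grad T u) * (elt_grad T u \<bullet> elt_grad T v)) \<and>
                integrable (surf d T) (\<lambda>x. f (P x) * v x)) \<and>
        (\<Sum>T\<in>\<T>. \<integral>x. b (P x) (u x) (elt_grad T u) * (elt_grad T u \<bullet> elt_grad T v) \<partial>surf d T)
          = (\<Sum>T\<in>\<T>. \<integral>x. f (P x) * v x \<partial>surf d T))"

definition is_max :: "'a set \<Rightarrow> ('a \<Rightarrow> real) \<Rightarrow> real \<Rightarrow> bool" where
  "is_max A \<phi> m \<longleftrightarrow> m \<in> \<phi> ` A \<and> (\<forall>x\<in>A. \<phi> x \<le> m)"

definition is_min :: "'a set \<Rightarrow> ('a \<Rightarrow> real) \<Rightarrow> real \<Rightarrow> bool" where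
  "is_min A \<phi> m \<longleftrightarrow> m \<in> \<phi> ` A \<and> (\<forall>x\<in>A. m \<le> \<phi> x)"

end

theory Submission
  imports Defs
begin

text \<open>Suppose that \<open>f \<le> 0\<close>. Write \<open>u = \<Sum>j. c j * hat j\<close>, let \<open>K\<close> be the largest nodal value on the
  boundary, and test the discrete equation with the truncation \<open>v = \<Sum>i\<le>n. max (c i - K) 0 * hat i\<close>, which is the nodal
  interpolant of the positive part of \<open>u - K\<close> and lies in the test space because it vanishes at
  all boundary vertices. Since the hat functions sum up to \<open>1\<close>, their gradients sum up to \<open>0\<close>, and the
  angle condition makes all mixed terms harmless: on every element
  \<open>grad u \<bullet> grad v \<ge> grad v \<bullet> grad v\<close> (\<open>truncation_gradient_estimate\<close>). As the coefficient is bounded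
  below by \<open>\<mu>\<^sub>0 > 0\<close> and \<open>f v \<le> 0\<close>, every element integral of \<open>b grad u \<bullet> grad v\<close> is nonnegative
  while their sum is nonpositive, so all of them vanish; hence \<open>grad v = 0\<close> on each element.
  Thus \<open>v\<close> is a continuous function with finitely many values on a connected surface, i.e. a
  constant, and it vanishes at a boundary vertex. So \<open>v = 0\<close>, which says that no nodal value of \<open>u\<close>
  exceeds \<open>K\<close>, and on each simplex \<open>u\<close> is bounded by its values at the vertices.

  The solution inside the coefficient is frozen: the argument is run for a weight \<open>\<beta>\<close> with a
  positive lower bound, where \<open>\<beta>\<close> may depend on the element. The equation is then linear in \<open>u\<close>, and the
  minimum principle is the maximum principle for \<open>-u\<close>.

  Two ingredients are not finite element algebra. An integral of a positive function over an element
  vanishes only if the element is a null set; so the Hausdorff measure of a simplex has to be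
  positive. This first requires that the Hausdorff outer measure is countably additive on Borel
  sets, which is Caratheodory's criterion for metric outer measures; the lower bound is obtained
  by comparing covers of the simplex with covers of a full-dimensional prism by boxes. Secondly, the
  polyhedral surface is connected, because the foot point map is a continuous bijection
  from a compact set onto the connected surface \<open>S\<close>, hence a homeomorphism.\<close>

section \<open>Metric outer measures and the Hausdorff measure\<close>

text \<open>Caratheodory's criterion. Given a test set \<open>E\<close> of finite measure, cut \<open>E - F\<close> into the part \<open>K k\<close> at distance at
  least \<open>1/(k+1)\<close> from \<open>F\<close> and the rings \<open>R j\<close>, \<open>j \<ge> k\<close>, between the distances \<open>1/(j+2)\<close> and
  \<open>1/(j+1)\<close>. Additivity on separated sets applies to \<open>E \<inter> F\<close> and \<open>K k\<close>. It also applies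
  to the rings of even index and to those of odd index, so the measures of all rings have a
  finite sum and the rings beyond \<open>k\<close> contribute arbitrarily little.\<close>

lemma metric_outer_measure_closed:
  fixes \<mu> :: "'a::metric_space set \<Rightarrow> ennreal"
  assumes om: "outer_measure_space UNIV \<mu>"
    and sep: "\<And>A B \<eta>. \<eta> > 0 \<Longrightarrow> (\<And>x y. x \<in> A \<Longrightarrow> y \<in> B \<Longrightarrow> \<eta> \<le> dist x y)
                \<Longrightarrow> \<mu> A + \<mu> B \<le> \<mu> (A \<union> B)"
    and "closed F"
  shows "F \<in> lambda_system UNIV UNIV \<mu>"
proof -
  have pos: "\<mu> {} = 0" and mono: "\<And>A B. A \<subseteq> B \<Longrightarrow> \<mu> A \<le> \<mu> B"
    using om by (auto simp: outer_measure_space_def positive_def increasing_def)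
  have csub: "countably_subadditive UNIV \<mu>"
    using om by (simp add: outer_measure_space_def)
  interpret sigma_algebra UNIV "UNIV :: 'a set set"
    using sigma_algebra_Pow[of UNIV] by simp
  have "subadditive UNIV \<mu>"
    using countably_subadditive_subadditive[OF _ csub] pos by (simp add: positive_def)
  then have sub: "\<mu> (A \<union> B) \<le> \<mu> A + \<mu> B" if "A \<inter> B = {}" for A B
    using that by (simp add: subadditive_def)
  have "\<mu> (E \<inter> F) + \<mu> (E - F) = \<mu> E" for E
  proof (cases "F = {} \<or> \<mu> E = top")
    case True
    have "\<mu> E \<le> \<mu> (E \<inter> F) + \<mu> (E - F)"
      using sub[of "E \<inter> F" "E - F"] by (auto simp: Int_Diff_Un)
    then have "\<mu> E = top \<Longrightarrow> ?thesis"
      by (simp add: top_unique)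
    then show ?thesis
      using True pos by fastforce
  next
    case False
    define D where "D x = infdist x F" for x
    have D_lip: "D x \<le> D y + dist x y" for x y
      unfolding D_def by (rule infdist_triangle)
    have D0: "D x = 0 \<longleftrightarrow> x \<in> F" for x
      using in_closed_iff_infdist_zero[OF \<open>closed F\<close>] False by (simp add: D_def)
    have Dpos: "D x \<ge> 0" for x
      by (simp add: D_def infdist_nonneg)
    define K where "K k = {x \<in> E. 1 / real (k + 1) \<le> D x}" for k
    define R where "R k = {x \<in> E. 1 / real (k + 2) \<le> D x \<and> D x < 1 / real (k + 1)}" for k
    \<comment> \<open>Two rings whose indices differ by two are a positive distance apart.\<close>
    have R_sum: "(\<Sum>i<m. \<mu> (R (2 * i + c))) \<le> \<mu> (\<Union>i<m. R (2 * i + c))" for m c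
    proof (induction m)
      case (Suc m)
      have "\<mu> (\<Union>i<m. R (2 * i + c)) + \<mu> (R (2 * m + c)) \<le> \<mu> ((\<Union>i<m. R (2 * i + c)) \<union> R (2 * m + c))"
      proof (cases "m = 0")
        case False
        then have "real (2 * m + c) > 0" by simp
        show ?thesis
        proof (rule sep[of "1 / real (2 * m + c) - 1 / real (2 * m + c + 1)"])
          have "1 / real (2 * m + c + 1) < 1 / real (2 * m + c)"
            using \<open>real (2 * m + c) > 0\<close> by (intro frac_less2) simp_all
          then show "0 < 1 / real (2 * m + c) - 1 / real (2 * m + c + 1)"
            by simp
        next
          fix x y assume x: "x \<in> (\<Union>i<m. R (2 * i + c))" and y: "y \<in> R (2 * m + c)"
          from x obtain i where i: "i < m" "1 / real (2 * i + c + 2) \<le> D x"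
            by (auto simp: R_def)
          have "real (2 * i + c + 2) \<le> real (2 * m + c)"
            using i by linarith
          then have "1 / real (2 * m + c) \<le> 1 / real (2 * i + c + 2)"
            by (intro divide_left_mono) auto
          moreover have "D y < 1 / real (2 * m + c + 1)"
            using y by (simp add: R_def)
          ultimately show "1 / real (2 * m + c) - 1 / real (2 * m + c + 1) \<le> dist x y"
            using i D_lip[of x y] by linarith
        qed
      qed (simp add: pos)
      also have "(\<Union>i<m. R (2 * i + c)) \<union> R (2 * m + c) = (\<Union>i<Suc m. R (2 * i + c))"
        by (auto simp: lessThan_Suc)
      finally have step: "\<mu> (\<Union>i<m. R (2 * i + c)) + \<mu> (R (2 * m + c)) \<le> \<mu> (\<Union>i<Suc m. R (2 * i + c))" .
      show ?case
        using order_trans[OF add_right_mono[OF Suc] step] by simp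
    qed (simp add: pos)
    have R_sub: "(\<Union>i<m. R (2 * i + c)) \<subseteq> E" for m c
      by (auto simp: R_def)
    have "(\<Sum>j<m. \<mu> (R j)) \<le> \<mu> E + \<mu> E" for m
    proof -
      have "(\<Sum>j<m. \<mu> (R j)) \<le> (\<Sum>j<2 * m. \<mu> (R j))"
        by (intro sum_mono2) auto
      also have "(\<Sum>j<2 * m. \<mu> (R j)) = (\<Sum>i<m. \<mu> (R (2 * i + 0))) + (\<Sum>i<m. \<mu> (R (2 * i + 1)))"
        by (induction m) (auto simp: algebra_simps)
      also have "\<dots> \<le> \<mu> E + \<mu> E"
        by (intro add_mono order_trans[OF R_sum] mono R_sub)
      finally show ?thesis .
    qed
    then have "(\<Sum>j. \<mu> (R j)) \<le> \<mu> E + \<mu> E"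
      by (intro suminf_le_const) auto
    moreover have "\<mu> E + \<mu> E \<noteq> top"
      using False by simp
    ultimately have fin: "(\<Sum>j. \<mu> (R j)) \<noteq> top"
      by (auto simp: top_unique)
    have K_sep: "\<mu> (E \<inter> F) + \<mu> (K k) \<le> \<mu> E" for k
    proof -
      have "\<mu> (E \<inter> F) + \<mu> (K k) \<le> \<mu> ((E \<inter> F) \<union> K k)"
      proof (rule sep[of "1 / real (k + 1)"])
        fix x y assume "x \<in> E \<inter> F" "y \<in> K k"
        then show "1 / real (k + 1) \<le> dist x y"
          using D_lip[of y x] D0[of x] by (auto simp: K_def dist_commute)
      qed simp
      also have "\<dots> \<le> \<mu> E"
        by (intro mono) (auto simp: K_def)
      finally show ?thesis .
    qed
    have split: "\<mu> (E - F) \<le> \<mu> (K k) + (\<Sum>j. \<mu> (R (j + k)))" for k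
    proof -
      define C where "C i = (case i of 0 \<Rightarrow> K k | Suc j \<Rightarrow> R (j + k))" for i
      have "E - F \<subseteq> (\<Union>i. C i)"
      proof
        fix x assume x: "x \<in> E - F"
        then have "D x > 0"
          using D0[of x] Dpos[of x] by simp
        define l where "l = (LEAST l. 1 / real (l + 1) \<le> D x)"
        obtain l0 where "1 / real (l0 + 1) < D x"
          using reals_Archimedean[OF \<open>D x > 0\<close>] by (auto simp: inverse_eq_divide)
        then have l: "1 / real (l + 1) \<le> D x"
          unfolding l_def by (metis (mono_tags, lifting) LeastI less_imp_le)
        show "x \<in> (\<Union>i. C i)"
        proof (cases "l \<le> k")
          case True
          then have "1 / real (k + 1) \<le> 1 / real (l + 1)"
            by (intro divide_left_mono) auto
          then have "x \<in> C 0"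
            using l x by (simp add: C_def K_def)
          then show ?thesis by blast
        next
          case False
          then obtain j where j: "l = Suc (j + k)"
            by (metis add.commute less_iff_Suc_add not_le)
          have "\<not> 1 / real (j + k + 1) \<le> D x"
            using not_less_Least[of "j + k" "\<lambda>l. 1 / real (l + 1) \<le> D x"] j unfolding l_def by simp
          then have "x \<in> C (Suc j)"
            using l x j by (simp add: C_def R_def)
          then show ?thesis by blast
        qed
      qed
      moreover have "disjoint_family C"
      proof -
        have R_disj: "R i \<inter> R j = {}" if "i < j" for i j
        proof -
          have "real (i + 2) \<le> real (j + 1)" using that by simp
          then have "1 / real (j + 1) \<le> 1 / real (i + 2)"
            by (intro divide_left_mono) auto
          then show ?thesis by (auto simp: R_def)
        qed
        have K_disj: "K k \<inter> R (j + k) = {}" for j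
        proof -
          have "1 / real (j + k + 1) \<le> 1 / real (k + 1)"
            by (intro divide_left_mono) auto
          then show ?thesis by (auto simp: K_def R_def)
        qed
        have "C i \<inter> C j = {}" if "i < j" for i j
          using that R_disj K_disj by (auto simp: C_def split: nat.split)
        then show ?thesis
          unfolding disjoint_family_on_def by (metis inf_commute linorder_neqE_nat)
      qed
      ultimately have "\<mu> (E - F) \<le> (\<Sum>i. \<mu> (C i))"
        using csub mono[of "E - F" "\<Union>i. C i"]
        unfolding countably_subadditive_def by (auto intro: order_trans)
      also have "\<dots> = \<mu> (K k) + (\<Sum>j. \<mu> (R (j + k)))"
        by (subst suminf_offset[of "\<lambda>i. \<mu> (C i)" 1]) (auto simp: C_def add.commute)
      finally show ?thesis .
    qed
    \<comment> \<open>Adding the first \<open>k\<close> rings on both sides avoids differences of extended reals; the finite sum over all rings is cancelled after \<open>k\<close> has gone to infinity.\<close>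
    have "\<mu> (E \<inter> F) + \<mu> (E - F) + (\<Sum>j<k. \<mu> (R j)) \<le> \<mu> E + (\<Sum>j. \<mu> (R j))" for k
    proof -
      have "\<mu> (E \<inter> F) + \<mu> (E - F) + (\<Sum>j<k. \<mu> (R j))
            \<le> \<mu> (E \<inter> F) + (\<mu> (K k) + (\<Sum>j. \<mu> (R (j + k)))) + (\<Sum>j<k. \<mu> (R j))"
        by (intro add_mono split order_refl)
      also have "\<dots> = (\<mu> (E \<inter> F) + \<mu> (K k)) + ((\<Sum>j. \<mu> (R (j + k))) + (\<Sum>j<k. \<mu> (R j)))"
        by (simp add: ac_simps)
      also have "\<dots> = (\<mu> (E \<inter> F) + \<mu> (K k)) + (\<Sum>j. \<mu> (R j))"
        by (subst suminf_offset[of "\<lambda>j. \<mu> (R j)" k]) auto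
      also have "\<dots> \<le> \<mu> E + (\<Sum>j. \<mu> (R j))"
        by (intro add_mono K_sep order_refl)
      finally show ?thesis .
    qed
    then have "\<mu> (E \<inter> F) + \<mu> (E - F) + (\<Sum>j. \<mu> (R j)) \<le> \<mu> E + (\<Sum>j. \<mu> (R j))"
      unfolding suminf_eq_SUP[of "\<lambda>j. \<mu> (R j)"] ennreal_SUP_add_right[OF UNIV_not_empty]
      by (intro SUP_least)
    then have "(\<Sum>j. \<mu> (R j)) + (\<mu> (E \<inter> F) + \<mu> (E - F)) \<le> (\<Sum>j. \<mu> (R j)) + \<mu> E"
      by (simp only: add.commute)
    then have "\<mu> (E \<inter> F) + \<mu> (E - F) \<le> \<mu> E"
      using fin by (simp add: ennreal_add_left_cancel_le)
    moreover have "\<mu> E \<le> \<mu> (E \<inter> F) + \<mu> (E - F)"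
      using sub[of "E \<inter> F" "E - F"] by (auto simp: Int_Diff_Un)
    ultimately show ?thesis by (rule antisym)
  qed
  then show ?thesis
    by (simp add: lambda_system_eq)
qed

lemma metric_outer_measure_space:
  fixes \<mu> :: "'a::metric_space set \<Rightarrow> ennreal"
  assumes om: "outer_measure_space UNIV \<mu>"
    and sep: "\<And>A B \<eta>. \<eta> > 0 \<Longrightarrow> (\<And>x y. x \<in> A \<Longrightarrow> y \<in> B \<Longrightarrow> \<eta> \<le> dist x y)
                \<Longrightarrow> \<mu> A + \<mu> B \<le> \<mu> (A \<union> B)"
  shows "measure_space UNIV (sets borel) \<mu>"
proof -
  interpret sigma_algebra UNIV "UNIV :: 'a set set"
    using sigma_algebra_Pow[of UNIV] by simp
  have ms: "measure_space UNIV (lambda_system UNIV UNIV \<mu>) \<mu>"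
    by (rule caratheodory_lemma[OF om])
  then interpret L: sigma_algebra UNIV "lambda_system UNIV UNIV \<mu>"
    by (simp add: measure_space_def)
  have "sets (borel :: 'a measure) = sigma_sets UNIV (Collect closed)"
    by (simp add: borel_eq_closed)
  also have "\<dots> \<subseteq> lambda_system UNIV UNIV \<mu>"
    using metric_outer_measure_closed[OF om sep]
    by (intro L.sigma_sets_subset) auto
  finally show ?thesis
    using measure_down[OF ms] sets.sigma_algebra_axioms[of "borel :: 'a measure"] by simp
qed

lemma hausdorff_pre_le:
  assumes "A \<subseteq> (\<Union>i. C i)" "\<And>i. bounded (C i)" "\<And>i. diameter (C i) \<le> \<epsilon>"
  shows "hausdorff_pre d \<epsilon> A \<le> (\<Sum>i. ennreal (unit_ball_vol (real d) * (diameter (C i) / 2) ^ d))"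
  unfolding hausdorff_pre_def by (rule INF_lower) (use assms in auto)

lemma hausdorff_pre_mono: "A \<subseteq> B \<Longrightarrow> hausdorff_pre d \<epsilon> A \<le> hausdorff_pre d \<epsilon> B"
  unfolding hausdorff_pre_def by (rule INF_superset_mono) auto

lemma hausdorff_pre_antimono: "\<epsilon> \<le> \<epsilon>' \<Longrightarrow> hausdorff_pre d \<epsilon>' A \<le> hausdorff_pre d \<epsilon> A"
  unfolding hausdorff_pre_def by (rule INF_superset_mono) (auto intro: order_trans)

text \<open>Near-optimal covers of the \<open>A n\<close>, with errors adding up to \<open>e\<close>, together form a cover of the union.\<close>

lemma hausdorff_pre_countably_subadditive:
  "hausdorff_pre d \<epsilon> (\<Union>n. A n) \<le> (\<Sum>n. hausdorff_pre d \<epsilon> (A n))"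
proof (rule ennreal_le_epsilon)
  fix e :: real assume e: "0 < e" and "(\<Sum>n. hausdorff_pre d \<epsilon> (A n)) < top"
  then have close: "hausdorff_pre d \<epsilon> (A n) < hausdorff_pre d \<epsilon> (A n) + e * (1/2)^Suc n" for n
    by (auto simp add: less_top dest!: ennreal_suminf_lessD)
  have "\<exists>C. A n \<subseteq> (\<Union>i. C i) \<and> (\<forall>i. bounded (C i) \<and> diameter (C i) \<le> \<epsilon>) \<and>
      (\<Sum>i. ennreal (unit_ball_vol (real d) * (diameter (C i) / 2) ^ d))
        \<le> hausdorff_pre d \<epsilon> (A n) + e * (1/2)^Suc n" for n
    using close[of n] unfolding hausdorff_pre_def[of d \<epsilon> "A n"]
    by (subst (asm) INF_less_iff) (auto intro: less_imp_le)
  then obtain C where C: "\<And>n. A n \<subseteq> (\<Union>i. C n i)" "\<And>n i. bounded (C n i)"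
      "\<And>n i. diameter (C n i) \<le> \<epsilon>"
      "\<And>n. (\<Sum>i. ennreal (unit_ball_vol (real d) * (diameter (C n i) / 2) ^ d))
        \<le> hausdorff_pre d \<epsilon> (A n) + e * (1/2)^Suc n"
    by metis
  define F where "F = case_prod C o prod_decode"
  have "(\<Union>n. A n) \<subseteq> (\<Union>i. F i)"
    using C(1) by (auto simp add: F_def subset_eq) (metis prod.case prod_encode_inverse)
  then have "hausdorff_pre d \<epsilon> (\<Union>n. A n)
      \<le> (\<Sum>i. ennreal (unit_ball_vol (real d) * (diameter (F i) / 2) ^ d))"
    by (rule hausdorff_pre_le) (auto simp: F_def C split_beta)
  also have "\<dots> = (\<Sum>n. \<Sum>i. ennreal (unit_ball_vol (real d) * (diameter (C n i) / 2) ^ d))"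
    unfolding F_def comp_def
    by (rule suminf_ennreal_2dimen
        [where f = "\<lambda>p. ennreal (unit_ball_vol (real d) * (diameter (case_prod C p) / 2) ^ d)"]) simp
  also have "\<dots> \<le> (\<Sum>n. hausdorff_pre d \<epsilon> (A n) + e * (1/2)^Suc n)"
    by (intro suminf_le C(4)) auto
  also have "\<dots> = (\<Sum>n. hausdorff_pre d \<epsilon> (A n)) + (\<Sum>n. ennreal e * ennreal ((1/2) ^ Suc n))"
    using e by (subst suminf_add[symmetric])
      (auto simp del: ennreal_suminf_cmult simp add: ennreal_mult[symmetric])
  also have "\<dots> = (\<Sum>n. hausdorff_pre d \<epsilon> (A n)) + e"
    unfolding ennreal_suminf_cmult
    by (subst suminf_ennreal_eq[OF zero_le_power power_half_series]) auto
  finally show "hausdorff_pre d \<epsilon> (\<Union>n. A n) \<le> (\<Sum>n. hausdorff_pre d \<epsilon> (A n)) + e" .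
qed

text \<open>A set of diameter below \<open>\<eta>\<close> cannot meet both \<open>A\<close> and \<open>B\<close>, so a cover of the union splits into a cover
  of \<open>A\<close> and a cover of \<open>B\<close>. The discarded sets are replaced by the empty set, whose weight is
  zero since \<open>d \<ge> 1\<close>.\<close>

lemma hausdorff_pre_separated:
  assumes "d \<ge> 1" "0 \<le> \<epsilon>" "\<epsilon> < \<eta>" and sep: "\<And>x y. x \<in> A \<Longrightarrow> y \<in> B \<Longrightarrow> \<eta> \<le> dist x y"
  shows "hausdorff_pre d \<epsilon> A + hausdorff_pre d \<epsilon> B \<le> hausdorff_pre d \<epsilon> (A \<union> B)"
  unfolding hausdorff_pre_def[of d \<epsilon> "A \<union> B"]
proof (rule INF_greatest, clarify)
  fix C :: "nat \<Rightarrow> 'a set"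
  assume C: "A \<union> B \<subseteq> (\<Union>i. C i)" "\<forall>i. bounded (C i) \<and> diameter (C i) \<le> \<epsilon>"
  let ?w = "\<lambda>X. ennreal (unit_ball_vol (real d) * (diameter X / 2) ^ d)"
  define CA where "CA i = (if C i \<inter> A = {} then {} else C i)" for i
  define CB where "CB i = (if C i \<inter> B = {} then {} else C i)" for i
  have w0: "?w {} = 0" using \<open>d \<ge> 1\<close> by (simp add: power_0_left)
  have excl: "C i \<inter> A = {} \<or> C i \<inter> B = {}" for i
  proof (rule ccontr)
    assume "\<not> ?thesis"
    then obtain x y where "x \<in> C i" "x \<in> A" "y \<in> C i" "y \<in> B" by blast
    then have "\<eta> \<le> dist x y" "dist x y \<le> diameter (C i)"
      using sep C(2) by (auto intro: diameter_bounded_bound)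
    then show False using C(2) \<open>\<epsilon> < \<eta>\<close> by (meson leD order_trans)
  qed
  have "hausdorff_pre d \<epsilon> A \<le> (\<Sum>i. ?w (CA i))"
    using C \<open>0 \<le> \<epsilon>\<close> by (intro hausdorff_pre_le) (auto simp: CA_def, blast)
  moreover have "hausdorff_pre d \<epsilon> B \<le> (\<Sum>i. ?w (CB i))"
    using C \<open>0 \<le> \<epsilon>\<close> by (intro hausdorff_pre_le) (auto simp: CB_def, blast)
  ultimately have "hausdorff_pre d \<epsilon> A + hausdorff_pre d \<epsilon> B \<le> (\<Sum>i. ?w (CA i)) + (\<Sum>i. ?w (CB i))"
    by (rule add_mono)
  also have "\<dots> = (\<Sum>i. ?w (CA i) + ?w (CB i))"
    by (rule suminf_add) auto
  also have "\<dots> \<le> (\<Sum>i. ?w (C i))"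
  proof (intro suminf_le)
    show "?w (CA i) + ?w (CB i) \<le> ?w (C i)" for i
      using excl[of i] w0 unfolding CA_def CB_def
      by (cases "C i \<inter> A = {}"; cases "C i \<inter> B = {}") (simp_all del: diameter_empty)
  qed auto
  finally show "hausdorff_pre d \<epsilon> A + hausdorff_pre d \<epsilon> B \<le> (\<Sum>i. ?w (C i))" .
qed

lemma hausdorff_pre_le_outer: "\<epsilon> > 0 \<Longrightarrow> hausdorff_pre d \<epsilon> A \<le> hausdorff_outer d A"
  unfolding hausdorff_outer_def by (rule SUP_upper) auto

text \<open>For \<open>d = 0\<close> this would fail: each empty set in a cover would then have weight one.\<close>

lemma outer_measure_space_hausdorff:
  assumes "d \<ge> 1"
  shows "outer_measure_space UNIV (hausdorff_outer d :: 'a::metric_space set \<Rightarrow> ennreal)"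
  unfolding outer_measure_space_def
proof (intro conjI)
  have "hausdorff_pre d \<epsilon> ({} :: 'a set) = 0" if "\<epsilon> > 0" for \<epsilon>
  proof -
    have "hausdorff_pre d \<epsilon> ({} :: 'a set)
        \<le> (\<Sum>i. ennreal (unit_ball_vol (real d) * (diameter ({} :: 'a set) / 2) ^ d))"
      using that by (intro hausdorff_pre_le) auto
    also have "\<dots> = 0" using \<open>d \<ge> 1\<close> by (simp add: power_0_left)
    finally show ?thesis by simp
  qed
  then have "hausdorff_outer d ({} :: 'a set) = (SUP \<epsilon>\<in>{0::real<..}. 0)"
    unfolding hausdorff_outer_def by (intro SUP_cong) auto
  then show "positive UNIV (hausdorff_outer d :: 'a set \<Rightarrow> ennreal)"
    unfolding positive_def by (simp add: SUP_constant bot_ennreal)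
  show "increasing UNIV (hausdorff_outer d :: 'a set \<Rightarrow> ennreal)"
    unfolding increasing_def hausdorff_outer_def
    by (intro ballI impI SUP_mono) (metis hausdorff_pre_mono)
  show "countably_subadditive UNIV (hausdorff_outer d :: 'a set \<Rightarrow> ennreal)"
    unfolding countably_subadditive_def
  proof (intro allI impI)
    fix A :: "nat \<Rightarrow> 'a set"
    show "hausdorff_outer d (\<Union>i. A i) \<le> (\<Sum>i. hausdorff_outer d (A i))"
      unfolding hausdorff_outer_def[of d "\<Union>i. A i"]
      by (intro SUP_least order_trans[OF hausdorff_pre_countably_subadditive] suminf_le)
        (auto intro: hausdorff_pre_le_outer)
  qed
qed

lemma hausdorff_outer_separated:
  assumes "d \<ge> 1" "\<eta> > 0" and sep: "\<And>x y. x \<in> A \<Longrightarrow> y \<in> B \<Longrightarrow> \<eta> \<le> dist x y"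
  shows "hausdorff_outer d A + hausdorff_outer d B \<le> hausdorff_outer d (A \<union> B)"
proof -
  have "hausdorff_outer d A + hausdorff_outer d B
      = (SUP \<epsilon>\<in>{0<..}. hausdorff_pre d \<epsilon> A + hausdorff_pre d \<epsilon> B)"
    unfolding hausdorff_outer_def
  proof (rule SUP_add_directed_ennreal[symmetric])
    fix i j :: real assume "i \<in> {0<..}" "j \<in> {0<..}"
    then show "\<exists>k\<in>{0<..}. hausdorff_pre d i A + hausdorff_pre d j B
        \<le> hausdorff_pre d k A + hausdorff_pre d k B"
      by (intro bexI[of _ "min i j"] add_mono hausdorff_pre_antimono) auto
  qed
  also have "\<dots> \<le> hausdorff_outer d (A \<union> B)"
  proof (rule SUP_least)
    fix \<epsilon> :: real assume "\<epsilon> \<in> {0<..}"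
    define \<epsilon>' where "\<epsilon>' = min \<epsilon> (\<eta> / 2)"
    have \<epsilon>': "0 < \<epsilon>'" "\<epsilon>' < \<eta>" "\<epsilon>' \<le> \<epsilon>"
      using \<open>\<epsilon> \<in> _\<close> \<open>\<eta> > 0\<close> by (auto simp: \<epsilon>'_def min_less_iff_disj)
    have "hausdorff_pre d \<epsilon> A + hausdorff_pre d \<epsilon> B \<le> hausdorff_pre d \<epsilon>' A + hausdorff_pre d \<epsilon>' B"
      using \<epsilon>' by (intro add_mono hausdorff_pre_antimono)
    also have "\<dots> \<le> hausdorff_pre d \<epsilon>' (A \<union> B)"
      using \<epsilon>' \<open>d \<ge> 1\<close> sep by (intro hausdorff_pre_separated) auto
    also have "\<dots> \<le> hausdorff_outer d (A \<union> B)"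
      using \<epsilon>' by (intro hausdorff_pre_le_outer)
    finally show "hausdorff_pre d \<epsilon> A + hausdorff_pre d \<epsilon> B \<le> hausdorff_outer d (A \<union> B)" .
  qed
  finally show ?thesis .
qed

lemma space_hausdorff_measure [simp]: "space (hausdorff_measure d) = UNIV"
  by (simp add: hausdorff_measure_def space_measure_of_conv)

lemma sets_hausdorff_measure [simp]: "sets (hausdorff_measure d) = sets borel"
  unfolding hausdorff_measure_def
  using sets.sigma_sets_eq[of "borel :: 'a measure"] by (simp add: sets_measure_of_conv)

text \<open>A measure built with \<^const>\<open>measure_of\<close> takes the prescribed values only if these are countably
  additive, so this is where Caratheodory's criterion pays off.\<close>

lemma emeasure_hausdorff_measure:
  assumes "d \<ge> 1" "A \<in> sets borel"
  shows "emeasure (hausdorff_measure d) A = hausdorff_outer d A"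
proof -
  have "measure_space UNIV (sets (borel :: 'a measure)) (hausdorff_outer d)"
    using outer_measure_space_hausdorff hausdorff_outer_separated \<open>d \<ge> 1\<close>
    by (intro metric_outer_measure_space) blast+
  then show ?thesis
    unfolding hausdorff_measure_def using assms
    by (intro emeasure_measure_of_sigma) (auto simp: measure_space_def)
qed

section \<open>Simplices have positive Hausdorff measure\<close>

text \<open>The component \<open>z\<close> of \<open>w\<close> orthogonal to \<open>m\<close> is a direction of the first hyperplane, so \<open>w\<close> is
  constant along it, which forces \<open>z \<bullet> z = 0\<close>.\<close>

lemma hyperplane_subset_normals_parallel:
  fixes m w :: "'a::real_inner"
  assumes "m \<noteq> 0" "{x. m \<bullet> x = k} \<subseteq> {x. w \<bullet> x = c}"
  shows "\<exists>\<alpha>. w = \<alpha> *\<^sub>R m"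
proof -
  define x0 where "x0 = (k / (m \<bullet> m)) *\<^sub>R m"
  define z where "z = w - ((w \<bullet> m) / (m \<bullet> m)) *\<^sub>R m"
  have "m \<bullet> x0 = k" "m \<bullet> z = 0"
    using \<open>m \<noteq> 0\<close> by (auto simp: x0_def z_def inner_diff_right inner_commute)
  then have "x0 \<in> {x. m \<bullet> x = k}" "x0 + z \<in> {x. m \<bullet> x = k}"
    by (simp_all add: inner_add_right)
  then have "w \<bullet> x0 = c" "w \<bullet> (x0 + z) = c"
    using assms(2) by blast+
  then have "w \<bullet> z = 0" by (simp add: inner_add_right)
  moreover have "z \<bullet> z = w \<bullet> z - ((w \<bullet> m) / (m \<bullet> m)) * (m \<bullet> z)"
    unfolding z_def by (simp add: inner_diff_left)
  ultimately have "z = 0" using \<open>m \<bullet> z = 0\<close> by simp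
  then show ?thesis unfolding z_def by auto
qed

text \<open>If \<open>T\<close> spans a hyperplane that does not contain the direction \<open>e\<close>, flattening \<open>T\<close> along \<open>e\<close>
  loses no dimension, and the prism of height one over the flattened set is full-dimensional. Otherwise
  the prism would lie in a hyperplane with some normal \<open>a\<close>; moving along \<open>e\<close> gives \<open>a \<bullet> e = 0\<close>, so \<open>T\<close>
  itself lies in that hyperplane and \<open>a\<close> is a multiple of \<open>m\<close>, contradicting \<open>m \<bullet> e \<noteq> 0\<close>.\<close>

lemma prism_over_hyperplane_set:
  fixes T :: "'a::euclidean_space set"
  assumes "convex T" and hull: "affine hull T = {x. m \<bullet> x = k}" and "e \<in> Basis" "m \<bullet> e \<noteq> 0"
  shows "interior ((\<lambda>(x, t). (x - (x \<bullet> e) *\<^sub>R e) + t *\<^sub>R e) ` (T \<times> {0..1})) \<noteq> {}"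
    (is "interior (?h ` _) \<noteq> {}")
proof
  assume int: "interior (?h ` (T \<times> {0..1})) = {}"
  have "linear ?h"
    by (rule linearI) (auto simp: algebra_simps inner_add_left)
  then have "convex (?h ` (T \<times> {0..1}))"
    using \<open>convex T\<close> by (intro convex_linear_image convex_Times) auto
  from empty_interior_subset_hyperplane[OF this int]
  obtain a c where "a \<noteq> 0" and ac: "?h ` (T \<times> {0..1}) \<subseteq> {x. a \<bullet> x = c}" .
  have h: "a \<bullet> (x - (x \<bullet> e) *\<^sub>R e) + t * (a \<bullet> e) = c" if "x \<in> T" "0 \<le> t" "t \<le> 1" for x t
    using ac that by (force simp: inner_add_right)
  have "m \<noteq> 0" using \<open>m \<bullet> e \<noteq> 0\<close> by auto
  have "\<exists>x. m \<bullet> x = k"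
    using \<open>m \<noteq> 0\<close> by (intro exI[of _ "(k / (m \<bullet> m)) *\<^sub>R m"]) simp
  then obtain x0 where x0: "x0 \<in> T"
    using hull by (metis (mono_tags, lifting) affine_hull_empty empty_iff equals0I mem_Collect_eq)
  have "a \<bullet> e = 0"
    using h[OF x0, of 0] h[OF x0, of 1] by simp
  then have "T \<subseteq> {x. a \<bullet> x = c}"
    using h[of _ 0] by (auto simp: inner_diff_right)
  then have "affine hull T \<subseteq> {x. a \<bullet> x = c}"
    by (simp add: hull_minimal affine_hyperplane)
  then have on: "a \<bullet> x = c" if "m \<bullet> x = k" for x
    using hull that by auto
  then obtain \<alpha> where "a = \<alpha> *\<^sub>R m"
    using hyperplane_subset_normals_parallel[OF \<open>m \<noteq> 0\<close>, of k a c] by blast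
  with \<open>a \<bullet> e = 0\<close> \<open>m \<bullet> e \<noteq> 0\<close> have "a = 0" by auto
  with \<open>a \<noteq> 0\<close> show False ..
qed

lemma simplex_hyperplane:
  fixes T :: "'a::euclidean_space set"
  assumes "DIM('a) = d + 1" "int d simplex T"
  obtains m k where "m \<noteq> 0" "affine hull T = {x. m \<bullet> x = k}"
proof -
  have "aff_dim T = DIM('a) - 1"
    using aff_dim_simplex[OF assms(2)] assms(1) by simp
  then show ?thesis
    using that unfolding aff_dim_eq_hyperplane by blast
qed

lemma emeasure_lborel_open_pos:
  fixes U :: "'a::euclidean_space set"
  assumes "open U" "U \<noteq> {}"
  shows "emeasure lborel U > 0"
proof -
  have "\<not> negligible U"
    using assms open_not_negligible by blast
  then have "emeasure lborel U \<noteq> 0"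
    using \<open>open U\<close> by (simp add: negligible_iff_null_sets null_sets_def emeasure_completion lborel_def)
  then show ?thesis by (simp add: zero_less_iff_neq_zero)
qed

text \<open>A set of diameter \<open>r\<close>, flattened along a coordinate direction \<open>e\<close> and thickened to height one, fits
  into a box of Lebesgue measure \<open>(2 * r) ^ d\<close>. So a cover of the simplex induces a cover of the
  prism over it by boxes, and up to a constant factor the Hausdorff weight of the cover is the total
  volume of the boxes, which is at least the volume of the interior of the prism.\<close>

lemma hausdorff_outer_simplex_pos:
  fixes T :: "'a::euclidean_space set"
  assumes "d \<ge> 1" "DIM('a) = d + 1" "int d simplex T"
  shows "hausdorff_outer d T > 0"
proof -
  obtain m k where "m \<noteq> 0" and hull: "affine hull T = {x. m \<bullet> x = k}"
    using simplex_hyperplane assms by blast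
  then obtain e where e: "e \<in> Basis" "m \<bullet> e \<noteq> 0"
    using euclidean_all_zero_iff by blast
  define h :: "'a \<times> real \<Rightarrow> 'a" where "h = (\<lambda>(x, t). (x - (x \<bullet> e) *\<^sub>R e) + t *\<^sub>R e)"
  define U where "U = interior (h ` (T \<times> {0..1}))"
  have U: "emeasure lborel U > 0"
    unfolding U_def h_def
    using prism_over_hyperplane_set[OF convex_simplex hull e] assms
    by (intro emeasure_lborel_open_pos) auto
  let ?V = "unit_ball_vol (real d)"
  have V: "?V > 0" by simp
  have "ennreal (?V / 4 ^ d) * emeasure lborel U \<le> hausdorff_pre d 1 T"
    unfolding hausdorff_pre_def
  proof (rule INF_greatest, clarify)
    fix C :: "nat \<Rightarrow> 'a set"
    assume C: "T \<subseteq> (\<Union>i. C i)" "\<forall>i. bounded (C i) \<and> diameter (C i) \<le> 1"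
    define r where "r i = diameter (C i)" for i
    have r: "r i \<ge> 0" for i
      using C by (simp add: r_def diameter_ge_0)
    \<comment> \<open>The centre is an arbitrary vector if \<open>C i\<close> is empty; the box then has volume zero.\<close>
    define z where "z i = (SOME x. x \<in> C i)" for i
    define l where "l i = (\<Sum>c\<in>Basis. (if c = e then 0 else z i \<bullet> c - r i) *\<^sub>R c)" for i
    define u where "u i = (\<Sum>c\<in>Basis. (if c = e then 1 else z i \<bullet> c + r i) *\<^sub>R c)" for i
    have box: "emeasure lborel (cbox (l i) (u i)) = ennreal ((2 * r i) ^ d)" for i
    proof -
      have "emeasure lborel (cbox (l i) (u i)) = (\<Prod>c\<in>Basis. if c = e then 1 else 2 * r i)"
        using r[of i] unfolding emeasure_lborel_cbox_eq
        by (auto simp: l_def u_def inner_diff_left intro!: arg_cong[where f=ennreal] prod.cong)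
      also have "(\<Prod>c\<in>Basis. if c = e then 1 else 2 * r i) = (\<Prod>c\<in>Basis - {e}. 2 * r i)"
        using e by (subst prod.remove[of _ e]) (auto intro!: prod.cong)
      finally show ?thesis
        using e assms by simp
    qed
    have "U \<subseteq> (\<Union>i. cbox (l i) (u i))"
    proof
      fix y assume "y \<in> U"
      then have "y \<in> h ` (T \<times> {0..1})"
        unfolding U_def using interior_subset by blast
      then obtain x t where x: "x \<in> T" "0 \<le> t" "t \<le> 1" "y = (x - (x \<bullet> e) *\<^sub>R e) + t *\<^sub>R e"
        unfolding h_def by auto
      then obtain i where i: "x \<in> C i" using C by blast
      then have "z i \<in> C i" unfolding z_def by (rule someI)
      then have dist: "norm (x - z i) \<le> r i"
        using i C diameter_bounded_bound[of "C i" x "z i"] by (auto simp: r_def dist_norm)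
      have "y \<in> cbox (l i) (u i)"
        unfolding mem_box
      proof
        fix c :: 'a assume c: "c \<in> Basis"
        show "l i \<bullet> c \<le> y \<bullet> c \<and> y \<bullet> c \<le> u i \<bullet> c"
        proof (cases "c = e")
          case True
          then show ?thesis using x e by (simp add: l_def u_def inner_add_left inner_diff_left)
        next
          case False
          then have "y \<bullet> c = x \<bullet> c"
            using x e c by (simp add: inner_add_left inner_diff_left inner_not_same_Basis)
          moreover have "\<bar>x \<bullet> c - z i \<bullet> c\<bar> \<le> r i"
            using dist Basis_le_norm[OF c, of "x - z i"] by (simp add: inner_diff_left)
          ultimately show ?thesis
            using False c by (auto simp: l_def u_def)
        qed
      qed
      then show "y \<in> (\<Union>i. cbox (l i) (u i))" by blast
    qed
    then have "emeasure lborel U \<le> emeasure lborel (\<Union>i. cbox (l i) (u i))"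
      by (intro emeasure_mono) auto
    also have "\<dots> \<le> (\<Sum>i. emeasure lborel (cbox (l i) (u i)))"
      by (intro emeasure_subadditive_countably) auto
    finally have "emeasure lborel U \<le> (\<Sum>i. ennreal ((2 * r i) ^ d))"
      unfolding box .
    then have "ennreal (?V / 4 ^ d) * emeasure lborel U
        \<le> ennreal (?V / 4 ^ d) * (\<Sum>i. ennreal ((2 * r i) ^ d))"
      by (rule mult_left_mono) simp
    also have "\<dots> = (\<Sum>i. ennreal (?V / 4 ^ d) * ennreal ((2 * r i) ^ d))"
      by simp
    also have "\<dots> = (\<Sum>i. ennreal (?V * (r i / 2) ^ d))"
    proof (rule suminf_cong)
      fix i
      have "4 ^ d * (r i / 2) ^ d = (4 * (r i / 2)) ^ d"
        by (simp only: power_mult_distrib)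
      then have "(2 * r i) ^ d = 4 ^ d * (r i / 2) ^ d"
        by simp
      then have "?V / 4 ^ d * (2 * r i) ^ d = ?V * (r i / 2) ^ d"
        by simp
      then show "ennreal (?V / 4 ^ d) * ennreal ((2 * r i) ^ d) = ennreal (?V * (r i / 2) ^ d)"
        using r[of i] V by (subst ennreal_mult[symmetric]) auto
    qed
    finally show "ennreal (?V / 4 ^ d) * emeasure lborel U
        \<le> (\<Sum>i. ennreal (?V * (diameter (C i) / 2) ^ d))"
      by (simp add: r_def)
  qed
  also have "\<dots> \<le> hausdorff_outer d T"
    by (rule hausdorff_pre_le_outer) simp
  finally have "ennreal (?V / 4 ^ d) * emeasure lborel U \<le> hausdorff_outer d T" .
  moreover have "0 < ennreal (?V / 4 ^ d) * emeasure lborel U"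
    using U V by (simp add: ennreal_zero_less_mult_iff)
  ultimately show ?thesis by (rule less_le_trans[rotated])
qed

text \<open>The form in which positivity of the measure is used: a positive integrable function on an element
  has a positive integral.\<close>

lemma surf_simplex_not_null:
  fixes T :: "'a::euclidean_space set"
  assumes "d \<ge> 1" "DIM('a) = d + 1" "int d simplex T"
  shows "\<not> (AE x in surf d T. False)"
proof -
  have T: "T \<in> sets borel"
    using closed_simplex[OF assms(3)] by simp
  have "emeasure (surf d T) (space (surf d T)) = hausdorff_outer d T"
    unfolding surf_def using T \<open>d \<ge> 1\<close>
    by (simp add: emeasure_restrict_space space_restrict_space emeasure_hausdorff_measure)
  also have "\<dots> > 0"
    by (rule hausdorff_outer_simplex_pos[OF assms])
  finally show ?thesis
    by (subst AE_iff_null) (auto simp: null_sets_def)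
qed

section \<open>Affine functions on a simplex and their tangential gradients\<close>

text \<open>The shape in which the choice in \<^const>\<open>elt_grad\<close> looks for affine functions.\<close>

definition affine_on :: "'a::euclidean_space set \<Rightarrow> ('a \<Rightarrow> real) \<Rightarrow> bool" where
  "affine_on T \<phi> \<longleftrightarrow> (\<exists>a c. \<forall>x\<in>T. \<phi> x = a \<bullet> x + c)"

text \<open>In codimension one the vectors orthogonal to the simplex form a line. This makes both choices in
  \<^const>\<open>elt_grad\<close> harmless.\<close>

lemma simplex_normals_parallel:
  fixes T :: "'a::euclidean_space set"
  assumes "DIM('a) = d + 1" "int d simplex T"
  obtains m where "m \<noteq> 0" "\<And>w. (\<forall>x\<in>T. \<forall>y\<in>T. w \<bullet> (x - y) = 0) \<longleftrightarrow> (\<exists>\<alpha>. w = \<alpha> *\<^sub>R m)"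
proof -
  obtain m k where m: "m \<noteq> 0" and hull: "affine hull T = {x. m \<bullet> x = k}"
    using simplex_hyperplane assms by blast
  have "(\<forall>x\<in>T. \<forall>y\<in>T. w \<bullet> (x - y) = 0) \<longleftrightarrow> (\<exists>\<alpha>. w = \<alpha> *\<^sub>R m)" for w
  proof
    assume w: "\<forall>x\<in>T. \<forall>y\<in>T. w \<bullet> (x - y) = 0"
    \<comment> \<open>The empty set is a simplex of dimension \<open>-1\<close> only.\<close>
    have "T \<noteq> {}" using assms(2) by auto
    then obtain x0 where x0: "x0 \<in> T" by blast
    have "T \<subseteq> {x. w \<bullet> x = w \<bullet> x0}"
    proof
      fix x assume "x \<in> T"
      then have "w \<bullet> (x - x0) = 0"
        using w x0 by blast
      then show "x \<in> {x. w \<bullet> x = w \<bullet> x0}"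
        by (simp add: inner_diff_right)
    qed
    then have "affine hull T \<subseteq> {x. w \<bullet> x = w \<bullet> x0}"
      by (simp add: hull_minimal affine_hyperplane)
    then show "\<exists>\<alpha>. w = \<alpha> *\<^sub>R m"
      using hyperplane_subset_normals_parallel m hull by metis
  next
    assume "\<exists>\<alpha>. w = \<alpha> *\<^sub>R m"
    moreover have "T \<subseteq> {x. m \<bullet> x = k}"
      using hull hull_subset by metis
    ultimately show "\<forall>x\<in>T. \<forall>y\<in>T. w \<bullet> (x - y) = 0"
      by (auto simp: inner_diff_right subset_iff)
  qed
  with m show ?thesis by (rule that)
qed

lemma elt_normal:
  fixes T :: "'a::euclidean_space set"
  assumes "DIM('a) = d + 1" "int d simplex T"
  shows "norm (elt_normal T) = 1" "\<And>x y. x \<in> T \<Longrightarrow> y \<in> T \<Longrightarrow> elt_normal T \<bullet> (x - y) = 0"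
proof -
  obtain m where m: "m \<noteq> 0" "\<And>w. (\<forall>x\<in>T. \<forall>y\<in>T. w \<bullet> (x - y) = 0) \<longleftrightarrow> (\<exists>\<alpha>. w = \<alpha> *\<^sub>R m)"
    by (rule simplex_normals_parallel[OF assms]) (rule that)
  have "\<exists>n. norm n = 1 \<and> (\<forall>x\<in>T. \<forall>y\<in>T. n \<bullet> (x - y) = 0)"
    unfolding m(2) using m(1) by (intro exI[of _ "(1 / norm m) *\<^sub>R m"]) auto
  then have "norm (elt_normal T) = 1 \<and> (\<forall>x\<in>T. \<forall>y\<in>T. elt_normal T \<bullet> (x - y) = 0)"
    unfolding elt_normal_def by (rule someI_ex)
  then show "norm (elt_normal T) = 1" "\<And>x y. x \<in> T \<Longrightarrow> y \<in> T \<Longrightarrow> elt_normal T \<bullet> (x - y) = 0"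
    by auto
qed

lemma tang_eq_0_iff_normal:
  fixes T :: "'a::euclidean_space set"
  assumes "DIM('a) = d + 1" "int d simplex T"
  shows "tang (elt_normal T) w = 0 \<longleftrightarrow> (\<forall>x\<in>T. \<forall>y\<in>T. w \<bullet> (x - y) = 0)"
proof
  assume "tang (elt_normal T) w = 0"
  then have w: "w = (w \<bullet> elt_normal T) *\<^sub>R elt_normal T"
    by (simp add: tang_def)
  show "\<forall>x\<in>T. \<forall>y\<in>T. w \<bullet> (x - y) = 0"
    using elt_normal(2)[OF assms] by (subst w) simp
next
  assume w: "\<forall>x\<in>T. \<forall>y\<in>T. w \<bullet> (x - y) = 0"
  obtain m where "m \<noteq> 0" and m: "\<And>w. (\<forall>x\<in>T. \<forall>y\<in>T. w \<bullet> (x - y) = 0) \<longleftrightarrow> (\<exists>\<alpha>. w = \<alpha> *\<^sub>R m)"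
    by (rule simplex_normals_parallel[OF assms]) (rule that)
  obtain \<alpha> where "w = \<alpha> *\<^sub>R m"
    using w unfolding m by blast
  moreover have "\<exists>\<beta>. elt_normal T = \<beta> *\<^sub>R m"
    unfolding m[symmetric] using elt_normal(2)[OF assms] by blast
  then obtain \<beta> where n: "elt_normal T = \<beta> *\<^sub>R m" ..
  moreover have "\<beta> \<noteq> 0"
    using n elt_normal(1)[OF assms] by auto
  ultimately have w: "w = (\<alpha> / \<beta>) *\<^sub>R elt_normal T"
    by simp
  have "elt_normal T \<bullet> elt_normal T = 1"
    using elt_normal(1)[OF assms] by (simp add: dot_square_norm)
  then show "tang (elt_normal T) w = 0"
    by (simp add: tang_def w)
qed

lemma tang_sum: "tang n (\<Sum>j\<in>J. c j *\<^sub>R a j) = (\<Sum>j\<in>J. c j *\<^sub>R tang n (a j))"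
  by (simp add: tang_def inner_sum_left scaleR_right_diff_distrib sum_subtractf
      scaleR_sum_left)

text \<open>Two affine representations of a function on \<open>T\<close> have linear parts that differ by a normal vector, and
  the tangential projection removes that difference.\<close>

lemma elt_grad_eq:
  fixes T :: "'a::euclidean_space set"
  assumes "DIM('a) = d + 1" "int d simplex T" and \<phi>: "\<And>x. x \<in> T \<Longrightarrow> \<phi> x = a \<bullet> x + c"
  shows "elt_grad T \<phi> = tang (elt_normal T) a"
proof -
  define a' where "a' = (SOME a. \<exists>c. \<forall>x\<in>T. \<phi> x = a \<bullet> x + c)"
  have "\<exists>c. \<forall>x\<in>T. \<phi> x = a' \<bullet> x + c"
    unfolding a'_def by (rule someI[of _ a]) (use \<phi> in blast)
  then obtain c' where c': "\<forall>x\<in>T. \<phi> x = a' \<bullet> x + c'" by blast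
  have "(a' - a) \<bullet> (x - y) = 0" if "x \<in> T" "y \<in> T" for x y
    using \<phi>[OF that(1)] \<phi>[OF that(2)] c' that by (simp add: inner_diff_left inner_diff_right)
  then have "tang (elt_normal T) (a' - a) = 0"
    using tang_eq_0_iff_normal[OF assms(1,2)] by blast
  then show ?thesis
    unfolding elt_grad_def a'_def[symmetric] by (simp add: tang_def inner_diff_left algebra_simps)
qed

lemma elt_grad_cong: "(\<And>x. x \<in> T \<Longrightarrow> \<phi> x = \<psi> x) \<Longrightarrow> elt_grad T \<phi> = elt_grad T \<psi>"
  by (simp add: elt_grad_def)

lemma affine_on_sum:
  assumes "\<And>j. j \<in> J \<Longrightarrow> affine_on T (\<phi> j)"
  shows "affine_on T (\<lambda>x. \<Sum>j\<in>J. c j * \<phi> j x)"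
proof -
  obtain a e where "\<forall>j\<in>J. \<forall>x\<in>T. \<phi> j x = a j \<bullet> x + e j"
    using assms unfolding affine_on_def by metis
  then have "\<forall>x\<in>T. (\<Sum>j\<in>J. c j * \<phi> j x) = (\<Sum>j\<in>J. c j *\<^sub>R a j) \<bullet> x + (\<Sum>j\<in>J. c j * e j)"
    by (simp add: inner_sum_left distrib_left sum.distrib)
  then show ?thesis unfolding affine_on_def by blast
qed

lemma elt_grad_sum:
  fixes T :: "'a::euclidean_space set"
  assumes "DIM('a) = d + 1" "int d simplex T" and "\<And>j. j \<in> J \<Longrightarrow> affine_on T (\<phi> j)"
  shows "elt_grad T (\<lambda>x. \<Sum>j\<in>J. c j * \<phi> j x) = (\<Sum>j\<in>J. c j *\<^sub>R elt_grad T (\<phi> j))"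
proof -
  obtain a e where ae: "\<And>j x. j \<in> J \<Longrightarrow> x \<in> T \<Longrightarrow> \<phi> j x = a j \<bullet> x + e j"
    using assms(3) unfolding affine_on_def by metis
  then have "(\<Sum>j\<in>J. c j * \<phi> j x) = (\<Sum>j\<in>J. c j *\<^sub>R a j) \<bullet> x + (\<Sum>j\<in>J. c j * e j)" if "x \<in> T" for x
    using that by (simp add: inner_sum_left distrib_left sum.distrib)
  then have "elt_grad T (\<lambda>x. \<Sum>j\<in>J. c j * \<phi> j x) = tang (elt_normal T) (\<Sum>j\<in>J. c j *\<^sub>R a j)"
    by (rule elt_grad_eq[OF assms(1,2)])
  also have "\<dots> = (\<Sum>j\<in>J. c j *\<^sub>R elt_grad T (\<phi> j))"
    unfolding tang_sum by (intro sum.cong refl) (simp add: elt_grad_eq[OF assms(1,2) ae])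
  finally show ?thesis .
qed

lemma elt_grad_const:
  fixes T :: "'a::euclidean_space set"
  assumes "DIM('a) = d + 1" "int d simplex T" "\<And>x. x \<in> T \<Longrightarrow> \<phi> x = c"
  shows "elt_grad T \<phi> = 0"
  using elt_grad_eq[OF assms(1,2), of \<phi> 0 c] assms(3) by (simp add: tang_def)

lemma elt_grad_0_imp_const:
  fixes T :: "'a::euclidean_space set"
  assumes "DIM('a) = d + 1" "int d simplex T" "affine_on T \<phi>" "elt_grad T \<phi> = 0" "x \<in> T" "y \<in> T"
  shows "\<phi> x = \<phi> y"
proof -
  obtain a c where ac: "\<And>x. x \<in> T \<Longrightarrow> \<phi> x = a \<bullet> x + c"
    using assms(3) unfolding affine_on_def by blast
  then have "a \<bullet> (x - y) = 0"
    using elt_grad_eq[OF assms(1,2) ac] tang_eq_0_iff_normal[OF assms(1,2)] assms(4-6) by metis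
  then show ?thesis
    using ac assms by (simp add: inner_diff_right)
qed

text \<open>By Minkowski's theorem \<open>T\<close> is the convex hull of its extreme points. The lemma is used for the elements
  of the mesh and for their facets.\<close>

lemma affine_on_le_at_extreme_points:
  assumes "compact T" "convex T" "affine_on T \<phi>" "\<And>v. v extreme_point_of T \<Longrightarrow> \<phi> v \<le> K" "x \<in> T"
  shows "\<phi> x \<le> K"
proof -
  obtain a c where ac: "\<And>x. x \<in> T \<Longrightarrow> \<phi> x = a \<bullet> x + c"
    using assms(3) unfolding affine_on_def by blast
  have "{v. v extreme_point_of T} \<subseteq> {x. a \<bullet> x \<le> K - c}"
    using ac assms(4) by (fastforce simp: extreme_point_of_def)
  then have "convex hull {v. v extreme_point_of T} \<subseteq> {x. a \<bullet> x \<le> K - c}"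
    by (simp add: hull_minimal convex_halfspace_le)
  then show ?thesis
    using Krein_Milman_Minkowski[OF assms(1,2)] ac assms(5) by auto
qed

section \<open>The foot point map and the lift\<close>

text \<open>The graph of the foot point map consists of the pairs \<open>(x, q)\<close> with \<open>x = q + \<delta> x *\<^sub>R \<nu> q\<close>, by
  uniqueness of \<open>q\<close>. This equation is closed because \<open>\<delta>\<close> and \<open>\<nu>\<close> are continuous, and a map into a compact
  set with closed graph is continuous.\<close>

lemma continuous_on_foot:
  fixes S :: "'a::euclidean_space set"
  assumes "compact S" "unit_normal S \<nu>" "signed_distance S \<nu> \<epsilon> \<delta>"
    and M: "compact M" "M \<subseteq> tube S \<nu> \<epsilon>" "\<forall>x\<in>M. \<exists>!q. q \<in> S \<and> x = q + \<delta> x *\<^sub>R \<nu> q"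
  shows "continuous_on M (foot S \<nu> \<delta>)"
proof (rule continuous_from_closed_graph[OF \<open>compact S\<close>])
  have foot: "foot S \<nu> \<delta> x \<in> S \<and> x = foot S \<nu> \<delta> x + \<delta> x *\<^sub>R \<nu> (foot S \<nu> \<delta> x)" if "x \<in> M" for x
    unfolding foot_def by (rule theI') (use M(3) that in blast)
  have foot_unique: "foot S \<nu> \<delta> x = q" if "x \<in> M" "q \<in> S" "x = q + \<delta> x *\<^sub>R \<nu> q" for x q
    using M(3) foot that by blast
  show "foot S \<nu> \<delta> \<in> M \<rightarrow> S" using foot by blast
  have "continuous_on (tube S \<nu> \<epsilon>) \<delta>"
    unfolding continuous_on_eq_continuous_within
  proof
    fix x assume "x \<in> tube S \<nu> \<epsilon>"
    then obtain q s where "q \<in> S" "\<bar>s\<bar> < \<epsilon>" "x = q + s *\<^sub>R \<nu> q"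
      by (auto simp: tube_def)
    then have "(\<delta> has_derivative (\<lambda>v. \<nu> q \<bullet> v)) (at x within tube S \<nu> \<epsilon>)"
      using assms(3) by (auto simp: signed_distance_def)
    then show "continuous (at x within tube S \<nu> \<epsilon>) \<delta>"
      by (rule has_derivative_continuous)
  qed
  then have \<delta>: "continuous_on M \<delta>"
    using M(2) continuous_on_subset by blast
  have \<nu>: "continuous_on S \<nu>"
    using assms(2) by (simp add: unit_normal_def)
  have "(\<lambda>x. (x, foot S \<nu> \<delta> x)) ` M
      = {z \<in> M \<times> S. fst z - (snd z + \<delta> (fst z) *\<^sub>R \<nu> (snd z)) = 0}"
    using foot foot_unique by (auto simp: image_iff)
  also have "closed \<dots>"
    using M(1) \<open>compact S\<close>
    by (intro continuous_closed_preimage_constant continuous_intros closed_Times compact_imp_closed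
        continuous_on_compose2[OF \<delta>] continuous_on_compose2[OF \<nu>]) auto
  finally show "closed ((\<lambda>x. (x, foot S \<nu> \<delta> x)) ` M)" .
qed

lemma connected_if_bijective_onto_connected:
  fixes f :: "'a::topological_space \<Rightarrow> 'b::t2_space"
  assumes "compact M" "continuous_on M f" "bij_betw f M S" "connected S"
  shows "connected M"
proof -
  have "continuous_on S (the_inv_into M f)"
    using continuous_on_inv_into[OF assms(2,1)] assms(3) by (simp add: bij_betw_def)
  then have "connected (the_inv_into M f ` S)"
    using connected_continuous_image \<open>connected S\<close> by blast
  then show ?thesis
    using bij_betw_the_inv_into[OF assms(3)] by (simp add: bij_betw_def)
qed

text \<open>The sign of \<open>f\<close> is known almost everywhere on \<open>S\<close> only. It can be used in the element
  integrals since preimages of null sets under the foot point map are null sets.\<close>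

lemma AE_foot:
  fixes S :: "'a::euclidean_space set"
  assumes lift: "lift_well_defined d S \<nu> \<epsilon> \<delta> \<T>" and "closed S" "closed T" "T \<in> \<T>"
    and Q: "AE x in surf d S. Q x"
  shows "AE x in surf d T. Q (foot S \<nu> \<delta> x)"
proof -
  let ?H = "hausdorff_measure d :: 'a measure"
  have bij: "bij_betw (foot S \<nu> \<delta>) (\<Union>\<T>) S"
    and null: "\<forall>Z. Z \<subseteq> S \<and> Z \<in> null_sets ?H \<longrightarrow>
        {x \<in> \<Union>\<T>. foot S \<nu> \<delta> x \<in> Z} \<in> null_sets ?H"
    using lift unfolding lift_well_defined_def by - (elim conjE, assumption)+
  have "AE x in ?H. x \<in> S \<longrightarrow> Q x"
    using Q \<open>closed S\<close> unfolding surf_def by (subst (asm) AE_restrict_space_iff) auto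
  then obtain Z where Z: "Z \<in> null_sets ?H" "{x. \<not> (x \<in> S \<longrightarrow> Q x)} \<subseteq> Z"
    by (auto simp: eventually_ae_filter)
  define W where "W = {x \<in> \<Union>\<T>. foot S \<nu> \<delta> x \<in> Z \<inter> S}"
  have "Z \<inter> S \<in> null_sets ?H"
    using Z(1) \<open>closed S\<close> by (intro null_set_Int2) auto
  then have "W \<in> null_sets ?H"
    unfolding W_def using null[rule_format, of "Z \<inter> S"] by simp
  then have "AE x in ?H. x \<notin> W"
    by (rule AE_not_in)
  then have "AE x in ?H. x \<in> T \<longrightarrow> Q (foot S \<nu> \<delta> x)"
  proof eventually_elim
    case (elim x)
    show ?case
    proof
      assume "x \<in> T"
      then have x: "x \<in> \<Union>\<T>" using \<open>T \<in> \<T>\<close> by blast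
      then have "foot S \<nu> \<delta> x \<in> S"
        by (rule bij_betw_apply[OF bij])
      then show "Q (foot S \<nu> \<delta> x)"
        using elim x Z(2) unfolding W_def by blast
    qed
  qed
  then show ?thesis
    using \<open>closed T\<close> unfolding surf_def by (subst AE_restrict_space_iff) auto
qed

lemma lift_image:
  assumes "bij_betw P (\<Union>\<T>) S" "x \<in> \<Union>\<T>"
  shows "lift \<T> P \<phi> (P x) = \<phi> x"
  using assms by (simp add: lift_def bij_betw_def)

lemma is_max_lift:
  assumes "bij_betw P (\<Union>\<T>) S" "A \<subseteq> \<Union>\<T>" "is_max A \<phi> m"
  shows "is_max (P ` A) (lift \<T> P \<phi>) m"
proof -
  have "lift \<T> P \<phi> (P x) = \<phi> x" if "x \<in> A" for x
    using lift_image[OF assms(1)] that assms(2) by blast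
  then show ?thesis
    using assms(3) by (simp add: is_max_def image_image cong: image_cong)
qed

lemma is_min_lift:
  assumes "bij_betw P (\<Union>\<T>) S" "A \<subseteq> \<Union>\<T>" "is_min A \<phi> m"
  shows "is_min (P ` A) (lift \<T> P \<phi>) m"
proof -
  have "lift \<T> P \<phi> (P x) = \<phi> x" if "x \<in> A" for x
    using lift_image[OF assms(1)] that assms(2) by blast
  then show ?thesis
    using assms(3) by (simp add: is_min_def image_image cong: image_cong)
qed

section \<open>The discrete maximum principle\<close>

text \<open>Put \<open>w j = max (c j - K) 0\<close> and \<open>z j = max (K - c j) 0\<close>, so that \<open>c j = w j - z j + K\<close>. The constant
  contributes nothing because the \<open>G j\<close> sum up to zero. What remains besides \<open>Gv \<bullet> Gv\<close> is minus the sum of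
  the terms \<open>w i * z j * (G i \<bullet> G j)\<close>; these vanish for \<open>i = j\<close>, as one of the two factors does, and
  are nonpositive otherwise.\<close>

lemma truncation_gradient_estimate:
  fixes G :: "nat \<Rightarrow> 'a::real_inner" and c :: "nat \<Rightarrow> real"
  assumes "n \<le> N" and G0: "(\<Sum>j\<in>{1..N}. G j) = 0"
    and angle: "\<And>i j. i \<in> {1..n} \<Longrightarrow> j \<in> {1..N} \<Longrightarrow> i \<noteq> j \<Longrightarrow> G i \<bullet> G j \<le> 0"
    and K: "\<And>j. j \<in> {n+1..N} \<Longrightarrow> c j \<le> K"
  defines "Gv \<equiv> \<Sum>j\<in>{1..n}. max (c j - K) 0 *\<^sub>R G j"
  shows "Gv \<bullet> Gv \<le> (\<Sum>j\<in>{1..N}. c j *\<^sub>R G j) \<bullet> Gv"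
proof -
  define w where "w j = max (c j - K) 0" for j
  define z where "z j = max (K - c j) 0" for j
  have Gv: "Gv = (\<Sum>j\<in>{1..n}. w j *\<^sub>R G j)"
    by (simp add: Gv_def w_def)
  also have "\<dots> = (\<Sum>j\<in>{1..N}. w j *\<^sub>R G j)"
    using \<open>n \<le> N\<close> K by (intro sum.mono_neutral_left) (auto simp: w_def not_le)
  finally have Gv': "Gv = (\<Sum>j\<in>{1..N}. w j *\<^sub>R G j)" .
  have "(\<Sum>j\<in>{1..N}. c j *\<^sub>R G j) = (\<Sum>j\<in>{1..N}. (w j - z j + K) *\<^sub>R G j)"
    by (intro sum.cong) (auto simp: w_def z_def max_def)
  also have "\<dots> = Gv - (\<Sum>j\<in>{1..N}. z j *\<^sub>R G j) + K *\<^sub>R (\<Sum>j\<in>{1..N}. G j)"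
    unfolding Gv' by (simp add: scaleR_add_left scaleR_diff_left sum.distrib sum_subtractf scaleR_sum_right)
  finally have u: "(\<Sum>j\<in>{1..N}. c j *\<^sub>R G j) = Gv - (\<Sum>j\<in>{1..N}. z j *\<^sub>R G j)"
    using G0 by simp
  have "(\<Sum>j\<in>{1..N}. z j *\<^sub>R G j) \<bullet> Gv = (\<Sum>i\<in>{1..n}. \<Sum>j\<in>{1..N}. w i * z j * (G i \<bullet> G j))"
    unfolding Gv
    by (subst sum.swap) (simp add: inner_sum_left inner_sum_right inner_commute ac_simps sum_distrib_left)
  also have "\<dots> \<le> 0"
  proof (intro sum_nonpos)
    fix i j assume ij: "i \<in> {1..n}" "j \<in> {1..N}"
    show "w i * z j * (G i \<bullet> G j) \<le> 0"
    proof (cases "i = j")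
      case True
      then have "w i * z j = 0" by (auto simp: w_def z_def max_def)
      then show ?thesis by (simp only: mult_zero_left order_refl)
    next
      case False
      then show ?thesis
        using angle[OF ij] by (intro mult_nonneg_nonpos) (auto simp: w_def z_def)
    qed
  qed
  finally show ?thesis
    unfolding u by (simp add: inner_diff_left)
qed

lemma fe_span_uminus: "v \<in> fe_span \<T> hat J \<Longrightarrow> (\<lambda>x. - v x) \<in> fe_span \<T> hat J"
proof -
  assume "v \<in> fe_span \<T> hat J"
  then obtain c where "\<forall>x\<in>\<Union>\<T>. v x = (\<Sum>j\<in>J. c j * hat j x)"
    unfolding fe_span_def by blast
  then have "\<forall>x\<in>\<Union>\<T>. - v x = (\<Sum>j\<in>J. (- c j) * hat j x)"
    by (simp add: sum_negf)
  then show ?thesis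
    unfolding fe_span_def mem_Collect_eq by (rule exI[of _ "\<lambda>j. - c j"])
qed

text \<open>A connected mesh of \<open>d\<close>-simplices of codimension one, with its vertices split into interior and
  boundary ones; the latter exist since \<open>n < N\<close>.\<close>

locale fe_mesh =
  fixes d n N :: nat and \<T> :: "'a::euclidean_space set set" and B :: "nat \<Rightarrow> 'a"
    and hat :: "nat \<Rightarrow> 'a \<Rightarrow> real"
  assumes dim: "d \<ge> 1" "DIM('a) = d + 1"
    and finite_mesh: "finite \<T>"
    and simplex: "\<And>T. T \<in> \<T> \<Longrightarrow> int d simplex T"
    and n_less_N: "n < N"
    and vertices: "bij_betw B {1..N} (mesh_vertices \<T>)"
    and interior_vertices: "\<And>i. i \<in> {1..n} \<Longrightarrow> B i \<notin> mesh_boundary \<T>"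
    and boundary_vertices: "\<And>i. i \<in> {n+1..N} \<Longrightarrow> B i \<in> mesh_boundary \<T>"
    and basis: "nodal_basis \<T> N B hat"
    and connected: "connected (\<Union>\<T>)"
begin

lemma vertex_in_mesh: "i \<in> {1..N} \<Longrightarrow> B i \<in> \<Union>\<T>"
  using bij_betw_apply[OF vertices] by (force simp: mesh_vertices_def extreme_point_of_def)

lemma extreme_point_is_vertex:
  assumes "T \<in> \<T>" "v extreme_point_of T"
  obtains i where "i \<in> {1..N}" "v = B i"
proof -
  have "v \<in> B ` {1..N}"
    using assms vertices by (auto simp: bij_betw_def mesh_vertices_def)
  then show ?thesis using that by blast
qed

lemma hat_vertex: "i \<in> {1..N} \<Longrightarrow> j \<in> {1..N} \<Longrightarrow> hat j (B i) = (if i = j then 1 else 0)"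
  using basis by (simp add: nodal_basis_def)

lemma hat_affine: "T \<in> \<T> \<Longrightarrow> j \<in> {1..N} \<Longrightarrow> affine_on T (hat j)"
  using basis unfolding nodal_basis_def affine_on_def by blast

lemma hat_continuous: "j \<in> {1..N} \<Longrightarrow> continuous_on (\<Union>\<T>) (hat j)"
  using basis by (simp add: nodal_basis_def)

lemma fe_affine: "T \<in> \<T> \<Longrightarrow> J \<subseteq> {1..N} \<Longrightarrow> affine_on T (\<lambda>x. \<Sum>j\<in>J. c j * hat j x)"
  by (intro affine_on_sum hat_affine) auto

lemma fe_vertex:
  assumes "i \<in> {1..N}" "J \<subseteq> {1..N}"
  shows "(\<Sum>j\<in>J. c j * hat j (B i)) = (if i \<in> J then c i else 0)"
proof -
  have "finite J" using assms(2) finite_subset by blast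
  have "(\<Sum>j\<in>J. c j * hat j (B i)) = (\<Sum>j\<in>J. if i = j then c j else 0)"
    using assms by (intro sum.cong) (auto simp: hat_vertex)
  then show ?thesis
    using \<open>finite J\<close> by simp
qed

lemma fe_le_nodal_values:
  assumes "x \<in> \<Union>\<T>" "\<And>j. j \<in> {1..N} \<Longrightarrow> c j \<le> K"
  shows "(\<Sum>j\<in>{1..N}. c j * hat j x) \<le> K"
proof -
  obtain T where T: "T \<in> \<T>" "x \<in> T" using assms by blast
  show ?thesis
  proof (rule affine_on_le_at_extreme_points[OF _ _ fe_affine _ T(2)])
    show "compact T" "convex T"
      using simplex[OF T(1)] compact_simplex convex_simplex by blast+
    fix v assume "v extreme_point_of T"
    then obtain i where "i \<in> {1..N}" "v = B i"
      using extreme_point_is_vertex[OF T(1)] by blast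
    then show "(\<Sum>j\<in>{1..N}. c j * hat j v) \<le> K"
      using assms(2) by (simp add: fe_vertex)
  qed (use T in auto)
qed

text \<open>The nodal values are all \<open>1\<close>, so bounding by nodal values from both sides leaves only \<open>1\<close>.\<close>

lemma partition_of_unity:
  assumes "x \<in> \<Union>\<T>"
  shows "(\<Sum>j\<in>{1..N}. hat j x) = 1"
  using fe_le_nodal_values[OF assms, of "\<lambda>_. 1" 1] fe_le_nodal_values[OF assms, of "\<lambda>_. -1" "-1"]
  by (simp add: sum_negf)

text \<open>Here the bound by nodal values is applied to \<open>- hat i\<close>.\<close>

lemma hat_nonneg:
  assumes "x \<in> \<Union>\<T>" "i \<in> {1..N}"
  shows "0 \<le> hat i x"
proof -
  have "(\<Sum>j\<in>{1..N}. (if j = i then -1 else 0) * hat j x) \<le> 0"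
    by (rule fe_le_nodal_values[OF assms(1)]) auto
  also have "(\<Sum>j\<in>{1..N}. (if j = i then -1 else 0) * hat j x) = (\<Sum>j\<in>{1..N}. if j = i then - hat j x else 0)"
    by (intro sum.cong) auto
  finally show ?thesis
    using assms(2) by simp
qed

lemma elt_grad_fe:
  assumes "T \<in> \<T>" "J \<subseteq> {1..N}" "\<And>x. x \<in> \<Union>\<T> \<Longrightarrow> u x = (\<Sum>j\<in>J. c j * hat j x)"
  shows "elt_grad T u = (\<Sum>j\<in>J. c j *\<^sub>R elt_grad T (hat j))"
proof -
  have "elt_grad T u = elt_grad T (\<lambda>x. \<Sum>j\<in>J. c j * hat j x)"
    using assms by (intro elt_grad_cong) auto
  also have "\<dots> = (\<Sum>j\<in>J. c j *\<^sub>R elt_grad T (hat j))"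
    using assms by (intro elt_grad_sum[OF dim(2)] simplex hat_affine) auto
  finally show ?thesis .
qed

lemma sum_elt_grad_hat:
  assumes "T \<in> \<T>"
  shows "(\<Sum>j\<in>{1..N}. elt_grad T (hat j)) = 0"
proof -
  have "(\<Sum>j\<in>{1..N}. elt_grad T (hat j)) = elt_grad T (\<lambda>_. 1)"
    using elt_grad_fe[OF assms order_refl, of "\<lambda>_. 1" "\<lambda>_. 1"] partition_of_unity by simp
  also have "\<dots> = 0"
    by (rule elt_grad_const[OF dim(2) simplex[OF assms]]) simp
  finally show ?thesis .
qed

text \<open>Constant on each of finitely many elements and continuous on a connected set, the function is
  constant; its value at the boundary vertex \<open>B N\<close> is zero.\<close>

lemma fe_eq_0_if_gradients_vanish:
  assumes v: "v = (\<lambda>x. \<Sum>j\<in>{1..n}. w j * hat j x)" and grad: "\<And>T. T \<in> \<T> \<Longrightarrow> elt_grad T v = 0"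
    and "i \<in> {1..n}"
  shows "w i = 0"
proof -
  have sub: "{1..n} \<subseteq> {1..N}" using n_less_N by auto
  have "continuous_on (\<Union>\<T>) v"
    unfolding v using sub by (intro continuous_intros hat_continuous) auto
  moreover have "finite (v ` \<Union>\<T>)"
  proof -
    have "finite (v ` T)" if T: "T \<in> \<T>" for T
    proof (cases "T = {}")
      case False
      then obtain y where y: "y \<in> T" by blast
      have affine: "affine_on T v"
        unfolding v using T sub by (rule fe_affine)
      have "v x = v y" if "x \<in> T" for x
        by (rule elt_grad_0_imp_const[OF dim(2) simplex[OF T] affine grad[OF T] that y])
      then have "v ` T \<subseteq> {v y}" by blast
      then show ?thesis using finite_subset by blast
    qed simp
    then show ?thesis
      using finite_mesh by (simp add: image_Union)
  qed
  ultimately have "v constant_on \<Union>\<T>"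
    by (rule continuous_finite_range_constant[OF connected])
  then obtain k where k: "\<And>x. x \<in> \<Union>\<T> \<Longrightarrow> v x = k"
    unfolding constant_on_def by blast
  have "v (B i) = v (B N)"
    using k[OF vertex_in_mesh, of i] k[OF vertex_in_mesh, of N] assms(3) n_less_N by simp
  then show ?thesis
    using assms(3) n_less_N fe_vertex[OF _ sub, of i w] fe_vertex[OF _ sub, of N w]
    by (simp add: v)
qed

text \<open>The heart of the matter: testing with the interpolant \<open>v\<close> of the positive part of \<open>u - K\<close>.\<close>

lemma nodal_values_le_boundary_bound:
  assumes angle: "\<And>i j T. i \<in> {1..n} \<Longrightarrow> j \<in> {1..N} \<Longrightarrow> i \<noteq> j \<Longrightarrow> T \<in> \<T> \<Longrightarrow>
        elt_grad T (hat i) \<bullet> elt_grad T (hat j) \<le> 0"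
    and u: "\<And>x. x \<in> \<Union>\<T> \<Longrightarrow> u x = (\<Sum>j\<in>{1..N}. c j * hat j x)"
    and "\<mu> > 0" and \<beta>: "\<And>T x. T \<in> \<T> \<Longrightarrow> x \<in> T \<Longrightarrow> \<mu> \<le> \<beta> T x"
    and F: "\<And>T. T \<in> \<T> \<Longrightarrow> AE x in surf d T. F x \<le> 0"
    and weak: "\<And>v. v \<in> fe_span \<T> hat {1..n} \<Longrightarrow>
        (\<forall>T\<in>\<T>. integrable (surf d T) (\<lambda>x. \<beta> T x * (elt_grad T u \<bullet> elt_grad T v)) \<and>
                integrable (surf d T) (\<lambda>x. F x * v x)) \<and>
        (\<Sum>T\<in>\<T>. \<integral>x. \<beta> T x * (elt_grad T u \<bullet> elt_grad T v) \<partial>surf d T)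
          = (\<Sum>T\<in>\<T>. \<integral>x. F x * v x \<partial>surf d T)"
    and K: "\<And>j. j \<in> {n+1..N} \<Longrightarrow> c j \<le> K"
    and "i \<in> {1..N}"
  shows "c i \<le> K"
proof (cases "i \<in> {1..n}")
  case True
  have sub: "{1..n} \<subseteq> {1..N}" using n_less_N by auto
  define w where "w j = max (c j - K) 0" for j
  define v where "v = (\<lambda>x. \<Sum>j\<in>{1..n}. w j * hat j x)"
  have "v \<in> fe_span \<T> hat {1..n}"
    unfolding fe_span_def v_def mem_Collect_eq by (rule exI[of _ w]) simp
  note weak_v = weak[OF this]
  have space: "space (surf d T) = T" for T
    by (simp add: surf_def space_restrict_space)
  have v_nonneg: "0 \<le> v x" if "x \<in> \<Union>\<T>" for x
    unfolding v_def w_def using that sub by (intro sum_nonneg mult_nonneg_nonneg hat_nonneg) auto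
  have grad: "elt_grad T v \<bullet> elt_grad T v \<le> elt_grad T u \<bullet> elt_grad T v" if T: "T \<in> \<T>" for T
  proof -
    have gv: "elt_grad T v = (\<Sum>j\<in>{1..n}. max (c j - K) 0 *\<^sub>R elt_grad T (hat j))"
      using elt_grad_fe[OF T sub, of v w] by (simp add: v_def w_def)
    have gu: "elt_grad T u = (\<Sum>j\<in>{1..N}. c j *\<^sub>R elt_grad T (hat j))"
      using elt_grad_fe[OF T order_refl u] .
    show ?thesis
      unfolding gu gv using n_less_N sum_elt_grad_hat[OF T] angle K T
      by (intro truncation_gradient_estimate) auto
  qed
  have integrand: "\<mu> * (elt_grad T v \<bullet> elt_grad T v) \<le> \<beta> T x * (elt_grad T u \<bullet> elt_grad T v)"
    if "T \<in> \<T>" "x \<in> T" for T x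
    using that grad[of T] \<beta>[of T x] \<open>\<mu> > 0\<close> by (intro mult_mono) auto
  have nonneg: "0 \<le> \<beta> T x * (elt_grad T u \<bullet> elt_grad T v)" if "T \<in> \<T>" "x \<in> T" for T x
    using order_trans[OF _ integrand[OF that]] \<open>\<mu> > 0\<close> by simp
  let ?I = "\<lambda>T. \<integral>x. \<beta> T x * (elt_grad T u \<bullet> elt_grad T v) \<partial>surf d T"
  have I_nonneg: "0 \<le> ?I T" if "T \<in> \<T>" for T
    using nonneg[OF that] by (intro integral_nonneg_AE AE_I2) (simp add: space)
  have "(\<integral>x. F x * v x \<partial>surf d T) \<le> 0" if T: "T \<in> \<T>" for T
  proof -
    have "AE x in surf d T. 0 \<le> - (F x * v x)"
      using F[OF T] AE_space
    proof eventually_elim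
      case (elim x)
      then have "0 \<le> v x" using v_nonneg T space by blast
      with elim show ?case by (simp add: mult_nonpos_nonneg)
    qed
    then have "0 \<le> (\<integral>x. - (F x * v x) \<partial>surf d T)"
      by (rule integral_nonneg_AE)
    then show ?thesis by simp
  qed
  then have "(\<Sum>T\<in>\<T>. ?I T) \<le> 0"
    unfolding conjunct2[OF weak_v] by (rule sum_nonpos)
  then have "(\<Sum>T\<in>\<T>. ?I T) = 0"
    using I_nonneg by (intro antisym sum_nonneg)
  then have I0: "?I T = 0" if "T \<in> \<T>" for T
    using sum_nonneg_eq_0_iff[OF finite_mesh, of ?I] I_nonneg that by blast
  have "elt_grad T v = 0" if T: "T \<in> \<T>" for T
  proof (rule ccontr)
    assume "elt_grad T v \<noteq> 0"
    then have pos: "0 < \<mu> * (elt_grad T v \<bullet> elt_grad T v)"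
      using \<open>\<mu> > 0\<close> by simp
    have "AE x in surf d T. \<beta> T x * (elt_grad T u \<bullet> elt_grad T v) = 0"
    proof (subst integral_nonneg_eq_0_iff_AE[symmetric])
      show "integrable (surf d T) (\<lambda>x. \<beta> T x * (elt_grad T u \<bullet> elt_grad T v))"
        using weak_v T by blast
      show "AE x in surf d T. 0 \<le> \<beta> T x * (elt_grad T u \<bullet> elt_grad T v)"
        using nonneg[OF T] by (intro AE_I2) (simp add: space)
      show "?I T = 0" by (rule I0[OF T])
    qed
    \<comment> \<open>The integrand has a positive lower bound on \<open>T\<close>.\<close>
    then have "AE x in surf d T. False"
      using AE_space
    proof eventually_elim
      case (elim x)
      then have "x \<in> T" by (simp add: space)
      then show ?case using integrand[OF T, of x] pos elim(1) by linarith
    qed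
    then show False
      by (rule notE[OF surf_simplex_not_null[OF dim simplex[OF T]]])
  qed
  then have "w i = 0"
    by (rule fe_eq_0_if_gradients_vanish[OF v_def _ True])
  then show ?thesis by (simp add: w_def max_def split: if_splits)
next
  case False
  then show ?thesis using K[of i] \<open>i \<in> {1..N}\<close> by auto
qed

lemma mesh_boundary_subset: "mesh_boundary \<T> \<subseteq> \<Union>\<T>"
proof
  fix x assume "x \<in> mesh_boundary \<T>"
  then obtain F where "x \<in> F" and F: "\<exists>!T. T \<in> \<T> \<and> F facet_of T"
    unfolding mesh_boundary_def by auto
  then show "x \<in> \<Union>\<T>"
    using ex1_implies_ex[OF F] facet_of_imp_subset by auto
qed

text \<open>A facet on the boundary contains no interior vertex, so all its extreme points are boundary
  vertices.\<close>

lemma boundary_values_le: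
  assumes x: "x \<in> mesh_boundary \<T>" and K: "\<And>j. j \<in> {n+1..N} \<Longrightarrow> \<gamma> j \<le> K"
  shows "(\<Sum>j\<in>{n+1..N}. \<gamma> j * hat j x) \<le> K"
proof -
  obtain F where F': "x \<in> F" "\<exists>!T. T \<in> \<T> \<and> F facet_of T"
    using x unfolding mesh_boundary_def by auto
  then have F: "x \<in> F" "F \<subseteq> mesh_boundary \<T>"
    unfolding mesh_boundary_def by auto
  obtain T where T: "T \<in> \<T>" "F facet_of T"
    using ex1_implies_ex[OF F'(2)] by auto
  have face: "F face_of T"
    using T(2) facet_of_imp_face_of by blast
  have T': "compact T" "convex T"
    using simplex[OF T(1)] compact_simplex convex_simplex by blast+
  have sub: "{n+1..N} \<subseteq> {1..N}" by auto
  show ?thesis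
  proof (rule affine_on_le_at_extreme_points[OF _ _ _ _ F(1)])
    show "compact F" "convex F"
      using face T' face_of_imp_compact face_of_imp_convex by blast+
    show "affine_on F (\<lambda>x. \<Sum>j\<in>{n+1..N}. \<gamma> j * hat j x)"
      using fe_affine[OF T(1) sub] face_of_imp_subset[OF face] unfolding affine_on_def by blast
    fix v assume v: "v extreme_point_of F"
    then have "v extreme_point_of T" "v \<in> F"
      using extreme_point_of_face[OF face] by blast+
    then obtain i where i: "i \<in> {1..N}" "v = B i"
      using extreme_point_is_vertex[OF T(1)] by blast
    then have "i \<notin> {1..n}"
      using interior_vertices F(2) \<open>v \<in> F\<close> by blast
    then have "i \<in> {n+1..N}" using i by auto
    then show "(\<Sum>j\<in>{n+1..N}. \<gamma> j * hat j v) \<le> K"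
      using K fe_vertex[OF i(1) sub] i(2) by simp
  qed
qed

text \<open>On boundary vertices the nodal values of \<open>u\<close> and \<open>gh\<close> agree, and their maximum \<open>K\<close> is attained both by
  \<open>u\<close> on the mesh and by \<open>gh\<close> on its boundary.\<close>

theorem discrete_maximum_principle:
  assumes angle: "\<And>i j T. i \<in> {1..n} \<Longrightarrow> j \<in> {1..N} \<Longrightarrow> i \<noteq> j \<Longrightarrow> T \<in> \<T> \<Longrightarrow>
        elt_grad T (hat i) \<bullet> elt_grad T (hat j) \<le> 0"
    and u: "u \<in> fe_span \<T> hat {1..N}" and ugh: "(\<lambda>x. u x - gh x) \<in> fe_span \<T> hat {1..n}"
    and gh: "\<And>x. x \<in> \<Union>\<T> \<Longrightarrow> gh x = (\<Sum>j\<in>{n+1..N}. \<gamma> j * hat j x)"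
    and "\<mu> > 0" and \<beta>: "\<And>T x. T \<in> \<T> \<Longrightarrow> x \<in> T \<Longrightarrow> \<mu> \<le> \<beta> T x"
    and F: "\<And>T. T \<in> \<T> \<Longrightarrow> AE x in surf d T. F x \<le> 0"
    and weak: "\<And>v. v \<in> fe_span \<T> hat {1..n} \<Longrightarrow>
        (\<forall>T\<in>\<T>. integrable (surf d T) (\<lambda>x. \<beta> T x * (elt_grad T u \<bullet> elt_grad T v)) \<and>
                integrable (surf d T) (\<lambda>x. F x * v x)) \<and>
        (\<Sum>T\<in>\<T>. \<integral>x. \<beta> T x * (elt_grad T u \<bullet> elt_grad T v) \<partial>surf d T)
          = (\<Sum>T\<in>\<T>. \<integral>x. F x * v x \<partial>surf d T)"
  shows "\<exists>K. is_max (\<Union>\<T>) u K \<and> is_max (mesh_boundary \<T>) gh K"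
proof -
  have sub: "{1..n} \<subseteq> {1..N}" "{n+1..N} \<subseteq> {1..N}" using n_less_N by auto
  obtain c where c: "\<And>x. x \<in> \<Union>\<T> \<Longrightarrow> u x = (\<Sum>j\<in>{1..N}. c j * hat j x)"
    using u unfolding fe_span_def by blast
  obtain e where e: "\<And>x. x \<in> \<Union>\<T> \<Longrightarrow> u x - gh x = (\<Sum>j\<in>{1..n}. e j * hat j x)"
    using ugh unfolding fe_span_def by blast
  have u_vertex: "u (B i) = c i" if "i \<in> {1..N}" for i
    using c[OF vertex_in_mesh[OF that]] fe_vertex[OF that order_refl] that by simp
  have gh_vertex: "gh (B i) = \<gamma> i" if "i \<in> {n+1..N}" for i
    using gh[OF vertex_in_mesh] fe_vertex[OF _ sub(2), of i] that by simp
  have c_\<gamma>: "c i = \<gamma> i" if "i \<in> {n+1..N}" for i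
    using e[OF vertex_in_mesh, of i] fe_vertex[OF _ sub(1), of i] u_vertex[of i] gh_vertex[OF that] that
    by simp
  define K where "K = Max (c ` {n+1..N})"
  have "K \<in> c ` {n+1..N}"
    unfolding K_def using n_less_N by (intro Max_in) auto
  then obtain k where k: "k \<in> {n+1..N}" "K = c k" by blast
  have K: "c j \<le> K" if "j \<in> {n+1..N}" for j
    unfolding K_def using that by (intro Max_ge) auto
  have le: "c i \<le> K" if "i \<in> {1..N}" for i
    by (rule nodal_values_le_boundary_bound[OF angle c \<open>\<mu> > 0\<close> \<beta> F weak K that])
  have "is_max (\<Union>\<T>) u K"
    unfolding is_max_def
  proof
    show "K \<in> u ` \<Union>\<T>"
      using k u_vertex[of k] vertex_in_mesh[of k] by (intro image_eqI[of _ _ "B k"]) auto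
    show "\<forall>x\<in>\<Union>\<T>. u x \<le> K"
      using fe_le_nodal_values[OF _ le] c by simp
  qed
  moreover have "is_max (mesh_boundary \<T>) gh K"
    unfolding is_max_def
  proof
    show "K \<in> gh ` mesh_boundary \<T>"
      using k gh_vertex[of k] c_\<gamma>[of k] boundary_vertices[of k] by (intro image_eqI[of _ _ "B k"]) auto
    show "\<forall>x\<in>mesh_boundary \<T>. gh x \<le> K"
    proof
      fix x assume x: "x \<in> mesh_boundary \<T>"
      have "(\<Sum>j\<in>{n+1..N}. \<gamma> j * hat j x) \<le> K"
        using K c_\<gamma> by (intro boundary_values_le[OF x]) force
      then show "gh x \<le> K"
        using gh[OF subsetD[OF mesh_boundary_subset x]] by simp
    qed
  qed
  ultimately show ?thesis by blast
qed

lemma elt_grad_uminus: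
  assumes "T \<in> \<T>" "u \<in> fe_span \<T> hat {1..N}"
  shows "elt_grad T (\<lambda>x. - u x) = - elt_grad T u"
proof -
  obtain c where c: "\<And>x. x \<in> \<Union>\<T> \<Longrightarrow> u x = (\<Sum>j\<in>{1..N}. c j * hat j x)"
    using assms(2) unfolding fe_span_def by blast
  have "elt_grad T (\<lambda>x. - u x) = (\<Sum>j\<in>{1..N}. (- c j) *\<^sub>R elt_grad T (hat j))"
    using c by (intro elt_grad_fe[OF assms(1)]) (auto simp: sum_negf)
  then show ?thesis
    using elt_grad_fe[OF assms(1) order_refl c] by (simp add: sum_negf)
qed

text \<open>With the weight \<open>\<beta>\<close> held fixed, changing the signs of \<open>u\<close>, \<open>gh\<close> and \<open>F\<close> turns a solution into a
  solution.\<close>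

corollary discrete_minimum_principle:
  assumes angle: "\<And>i j T. i \<in> {1..n} \<Longrightarrow> j \<in> {1..N} \<Longrightarrow> i \<noteq> j \<Longrightarrow> T \<in> \<T> \<Longrightarrow>
        elt_grad T (hat i) \<bullet> elt_grad T (hat j) \<le> 0"
    and u: "u \<in> fe_span \<T> hat {1..N}" and ugh: "(\<lambda>x. u x - gh x) \<in> fe_span \<T> hat {1..n}"
    and gh: "\<And>x. x \<in> \<Union>\<T> \<Longrightarrow> gh x = (\<Sum>j\<in>{n+1..N}. \<gamma> j * hat j x)"
    and "\<mu> > 0" and \<beta>: "\<And>T x. T \<in> \<T> \<Longrightarrow> x \<in> T \<Longrightarrow> \<mu> \<le> \<beta> T x"
    and F: "\<And>T. T \<in> \<T> \<Longrightarrow> AE x in surf d T. 0 \<le> F x"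
    and weak: "\<And>v. v \<in> fe_span \<T> hat {1..n} \<Longrightarrow>
        (\<forall>T\<in>\<T>. integrable (surf d T) (\<lambda>x. \<beta> T x * (elt_grad T u \<bullet> elt_grad T v)) \<and>
                integrable (surf d T) (\<lambda>x. F x * v x)) \<and>
        (\<Sum>T\<in>\<T>. \<integral>x. \<beta> T x * (elt_grad T u \<bullet> elt_grad T v) \<partial>surf d T)
          = (\<Sum>T\<in>\<T>. \<integral>x. F x * v x \<partial>surf d T)"
  shows "\<exists>K. is_min (\<Union>\<T>) u K \<and> is_min (mesh_boundary \<T>) gh K"
proof -
  have "\<exists>K. is_max (\<Union>\<T>) (\<lambda>x. - u x) K \<and> is_max (mesh_boundary \<T>) (\<lambda>x. - gh x) K"
  proof (rule discrete_maximum_principle[where \<gamma> = "\<lambda>j. - \<gamma> j" and F = "\<lambda>x. - F x", OF angle _ _ _ \<open>\<mu> > 0\<close> \<beta>])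
    show "(\<lambda>x. - u x) \<in> fe_span \<T> hat {1..N}"
      by (rule fe_span_uminus[OF u])
    show "(\<lambda>x. - u x - - gh x) \<in> fe_span \<T> hat {1..n}"
      using fe_span_uminus[OF ugh] by simp
    show "- gh x = (\<Sum>j\<in>{n+1..N}. - \<gamma> j * hat j x)" if "x \<in> \<Union>\<T>" for x
      using gh[OF that] by (simp add: sum_negf)
    show "AE x in surf d T. - F x \<le> 0" if "T \<in> \<T>" for T
      using F[OF that] by simp
  next
    fix v assume "v \<in> fe_span \<T> hat {1..n}"
    note w = weak[OF this]
    have flux: "\<beta> T x * (elt_grad T (\<lambda>x. - u x) \<bullet> elt_grad T v)
        = - (\<beta> T x * (elt_grad T u \<bullet> elt_grad T v))" if "T \<in> \<T>" for T x
      using elt_grad_uminus[OF that u] by simp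
    show "(\<forall>T\<in>\<T>. integrable (surf d T) (\<lambda>x. \<beta> T x * (elt_grad T (\<lambda>x. - u x) \<bullet> elt_grad T v)) \<and>
                integrable (surf d T) (\<lambda>x. - F x * v x)) \<and>
        (\<Sum>T\<in>\<T>. \<integral>x. \<beta> T x * (elt_grad T (\<lambda>x. - u x) \<bullet> elt_grad T v) \<partial>surf d T)
          = (\<Sum>T\<in>\<T>. \<integral>x. - F x * v x \<partial>surf d T)"
      using w by (simp add: flux sum_negf)
  qed
  then obtain K where K: "is_max (\<Union>\<T>) (\<lambda>x. - u x) K" "is_max (mesh_boundary \<T>) (\<lambda>x. - gh x) K"
    by blast
  have "is_min A \<phi> (- K)" if "is_max A (\<lambda>x. - \<phi> x) K" for A \<phi>
    using that by (fastforce simp: is_max_def is_min_def)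
  with K show ?thesis by blast
qed

end

section \<open>Maximum and minimum principles on the smooth surface\<close>

theorem theorem3p5:
  fixes d n N :: nat
    and S :: "'a::euclidean_space set"
    and \<nu> :: "'a \<Rightarrow> 'a" and \<delta> :: "'a \<Rightarrow> real" and \<epsilon> :: real
    and p \<gamma> \<mu>\<^sub>0 \<mu>\<^sub>1 M\<^sub>0 M\<^sub>1 c :: real
    and b :: "'a \<Rightarrow> real \<Rightarrow> 'a \<Rightarrow> real"
    and f g gs :: "'a \<Rightarrow> real"
    and \<T> :: "'a set set" and B :: "nat \<Rightarrow> 'a" and hat :: "nat \<Rightarrow> 'a \<Rightarrow> real"
    and P :: "'a \<Rightarrow> 'a" and gh u :: "'a \<Rightarrow> real"
  assumes dim: "d \<ge> 1" "DIM('a) = d + 1"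
    and surface: "regular_hypersurface S" "unit_normal S \<nu>" "signed_distance S \<nu> \<epsilon> \<delta>"
    and A1: "p \<ge> 2"
    and A2_b: "continuous_on (S \<times> UNIV \<times> UNIV) (\<lambda>(x, z, \<xi>). b x z \<xi>)"
    and A2_f: "in_Lp (surf d S) (p / (p - 1)) f"
    and A2_gamma: "p > real d \<longrightarrow> \<gamma> \<ge> p" "p \<le> real d \<longrightarrow> \<gamma> > real d"
    and A2_g: "in_W1 d S \<nu> \<gamma> gs" "continuous_on S gs" "\<forall>x\<in>hs_boundary S. g x = gs x"
    and A3_pos: "\<mu>\<^sub>0 > 0" "\<mu>\<^sub>1 > 0" "M\<^sub>0 > 0" "M\<^sub>1 > 0"
    and A3: "\<forall>x\<in>S. \<forall>z \<xi>. \<mu>\<^sub>0 + \<mu>\<^sub>1 * norm_pow \<xi> (p - 2) \<le> b x z \<xi> \<and>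
                            b x z \<xi> \<le> M\<^sub>0 + M\<^sub>1 * norm_pow \<xi> (p - 2)"
    and mesh: "admissible_mesh d c \<T>" "numbered_vertices S \<T> n N B" "nodal_basis \<T> N B hat"
    and lift_ok: "lift_well_defined d S \<nu> \<epsilon> \<delta> \<T>"
    and P: "P = foot S \<nu> \<delta>"
    and gh: "gh = boundary_interpolant n N B hat g"
    and angle: "\<forall>i\<in>{1..n}. \<forall>j\<in>{1..N}. i \<noteq> j \<longrightarrow>
                  (\<forall>T\<in>\<T>. elt_grad T (hat i) \<bullet> elt_grad T (hat j) \<le> 0)"
    and sol: "discrete_solution d \<T> n N hat P b f gh u"
  shows "((AE x in surf d S. f x \<le> 0) \<longrightarrow>
            (\<exists>m. is_max (closure S) (lift \<T> P u) m \<and> is_max (hs_boundary S) (lift \<T> P gh) m))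
       \<and> ((AE x in surf d S. f x \<ge> 0) \<longrightarrow>
            (\<exists>m. is_min (closure S) (lift \<T> P u) m \<and> is_min (hs_boundary S) (lift \<T> P gh) m))
       \<and> ((AE x in surf d S. f x = 0) \<longrightarrow>
            (\<exists>mu Mu mg Mg.
               is_min (closure S) (lift \<T> P u) mu \<and> is_max (closure S) (lift \<T> P u) Mu \<and>
               is_min (hs_boundary S) (lift \<T> P gh) mg \<and>
               is_max (hs_boundary S) (lift \<T> P gh) Mg \<and>
               {mu..Mu} = {mg..Mg}))"
proof -
  have compact_S: "compact S" and connected_S: "connected S"
    using surface(1) by (auto simp: regular_hypersurface_def)
  have closed_S: "closed S" using compact_S by (rule compact_imp_closed)
  have finite_mesh: "finite \<T>" and simplex: "\<And>T. T \<in> \<T> \<Longrightarrow> int d simplex T"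
    using mesh(1) by (auto simp: admissible_mesh_def triangulation_def)
  have compact_mesh: "compact (\<Union>\<T>)"
    using finite_mesh simplex compact_simplex by (intro compact_Union) blast+
  have bij: "bij_betw P (\<Union>\<T>) S" and boundary: "P ` mesh_boundary \<T> = hs_boundary S"
    using lift_ok by (auto simp: P lift_well_defined_def)
  have image: "P ` \<Union>\<T> = closure S"
    using bij closed_S by (simp add: bij_betw_def closure_closed)
  have P_in: "P x \<in> S" if "x \<in> \<Union>\<T>" for x
    using bij_betw_apply[OF bij that] .
  have "continuous_on (\<Union>\<T>) P"
    unfolding P
    by (rule continuous_on_foot[OF compact_S surface(2,3) compact_mesh])
      (use lift_ok in \<open>auto simp: lift_well_defined_def\<close>)
  then have "connected (\<Union>\<T>)"
    using connected_if_bijective_onto_connected[OF compact_mesh _ bij connected_S] by blast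
  then interpret fe_mesh d n N \<T> B hat
    using dim finite_mesh simplex mesh(2,3)
    by unfold_locales (auto simp: numbered_vertices_def)
  \<comment> \<open>Freezing the solution in the coefficient makes the equation linear.\<close>
  define \<beta> where "\<beta> T x = b (P x) (u x) (elt_grad T u)" for T x
  have \<beta>: "\<mu>\<^sub>0 \<le> \<beta> T x" if "T \<in> \<T>" "x \<in> T" for T x
  proof -
    have "0 \<le> \<mu>\<^sub>1 * norm_pow (elt_grad T u) (p - 2)"
      using A3_pos(2) by (simp add: norm_pow_def)
    moreover have "\<mu>\<^sub>0 + \<mu>\<^sub>1 * norm_pow (elt_grad T u) (p - 2) \<le> \<beta> T x"
      unfolding \<beta>_def using A3 P_in[of x] that by blast
    ultimately show ?thesis by linarith
  qed
  have u: "u \<in> fe_span \<T> hat {1..N}" "(\<lambda>x. u x - gh x) \<in> fe_span \<T> hat {1..n}"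
    using sol by (auto simp: discrete_solution_def)
  have weak: "(\<forall>T\<in>\<T>. integrable (surf d T) (\<lambda>x. \<beta> T x * (elt_grad T u \<bullet> elt_grad T v)) \<and>
                integrable (surf d T) (\<lambda>x. f (P x) * v x)) \<and>
        (\<Sum>T\<in>\<T>. \<integral>x. \<beta> T x * (elt_grad T u \<bullet> elt_grad T v) \<partial>surf d T)
          = (\<Sum>T\<in>\<T>. \<integral>x. f (P x) * v x \<partial>surf d T)" if "v \<in> fe_span \<T> hat {1..n}" for v
    using sol that unfolding discrete_solution_def \<beta>_def by blast
  have gh_sum: "gh x = (\<Sum>j\<in>{n+1..N}. g (B j) * hat j x)" for x
    by (simp add: gh boundary_interpolant_def)
  have closed_T: "closed T" if "T \<in> \<T>" for T
    using simplex[OF that] closed_simplex by blast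
  have angle': "elt_grad T (hat i) \<bullet> elt_grad T (hat j) \<le> 0"
    if "i \<in> {1..n}" "j \<in> {1..N}" "i \<noteq> j" "T \<in> \<T>" for i j T
    using angle that by blast
  have max: "\<exists>m. is_max (closure S) (lift \<T> P u) m \<and> is_max (hs_boundary S) (lift \<T> P gh) m"
    if f: "AE x in surf d S. f x \<le> 0"
  proof -
    have F: "AE x in surf d T. f (P x) \<le> 0" if "T \<in> \<T>" for T
      unfolding P by (rule AE_foot[OF lift_ok closed_S closed_T[OF that] that f])
    have "\<exists>K. is_max (\<Union>\<T>) u K \<and> is_max (mesh_boundary \<T>) gh K"
      by (rule discrete_maximum_principle[OF angle' u gh_sum A3_pos(1) \<beta> F weak])
    then obtain K where K: "is_max (\<Union>\<T>) u K" "is_max (mesh_boundary \<T>) gh K" by blast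
    have "is_max (closure S) (lift \<T> P u) K"
      using is_max_lift[OF bij order_refl K(1)] unfolding image .
    moreover have "is_max (hs_boundary S) (lift \<T> P gh) K"
      using is_max_lift[OF bij mesh_boundary_subset K(2)] unfolding boundary .
    ultimately show ?thesis by blast
  qed
  have min: "\<exists>m. is_min (closure S) (lift \<T> P u) m \<and> is_min (hs_boundary S) (lift \<T> P gh) m"
    if f: "AE x in surf d S. 0 \<le> f x"
  proof -
    have F: "AE x in surf d T. 0 \<le> f (P x)" if "T \<in> \<T>" for T
      unfolding P by (rule AE_foot[OF lift_ok closed_S closed_T[OF that] that f])
    have "\<exists>K. is_min (\<Union>\<T>) u K \<and> is_min (mesh_boundary \<T>) gh K"
      by (rule discrete_minimum_principle[OF angle' u gh_sum A3_pos(1) \<beta> F weak])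
    then obtain K where K: "is_min (\<Union>\<T>) u K" "is_min (mesh_boundary \<T>) gh K" by blast
    have "is_min (closure S) (lift \<T> P u) K"
      using is_min_lift[OF bij order_refl K(1)] unfolding image .
    moreover have "is_min (hs_boundary S) (lift \<T> P gh) K"
      using is_min_lift[OF bij mesh_boundary_subset K(2)] unfolding boundary .
    ultimately show ?thesis by blast
  qed
  have sign: "AE x in surf d S. f x \<le> 0" "AE x in surf d S. 0 \<le> f x" if "AE x in surf d S. f x = 0"
    using that by (auto elim: eventually_mono)
  show ?thesis
  proof (intro conjI impI)
    assume "AE x in surf d S. f x = 0"
    then obtain m m' where
      "is_max (closure S) (lift \<T> P u) m" "is_max (hs_boundary S) (lift \<T> P gh) m"
      "is_min (closure S) (lift \<T> P u) m'" "is_min (hs_boundary S) (lift \<T> P gh) m'"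
      using max[OF sign(1)] min[OF sign(2)] by auto
    then show "\<exists>mu Mu mg Mg.
               is_min (closure S) (lift \<T> P u) mu \<and> is_max (closure S) (lift \<T> P u) Mu \<and>
               is_min (hs_boundary S) (lift \<T> P gh) mg \<and>
               is_max (hs_boundary S) (lift \<T> P gh) Mg \<and>
               {mu..Mu} = {mg..Mg}"
      by (intro exI[of _ m'] exI[of _ m]) simp
  qed (fact max min)+
qed

end
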